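(* Let $J$ satisfy (A1)–(A3), let the admissible metric families $\mathcal D_1,\dots,\mathcal D_N$ satisfy (B1)–(B3), let $\{z^k\}_{k\in\mathbb N}$, $z^k=(x_1^k,\dots,x_N^k)$, be the sequence generated by the iGGBPL algorithm with step sizes satisfying $\inf_{i\in[N],k\ge1}(\gamma_i^k-1)s_i^k>0$ and $\inf_{i\in[N],k\ge1}\sigma_i^k>0$ (all described in the context), and let $z'$ be the set of cluster points of $\{z^k\}$. Then: (i) $J$ is constant on $z'$; (ii) $z'\subseteq\mathrm{crit}\,J$, where $\mathrm{crit}\,J=\{x:0\in\partial J(x)\}$.
   Context: Notation: $[N]=\{1,\dots,N\}$; $\langle\cdot,\cdot\rangle,\|\cdot\|$ are the Euclidean inner product and norm. Problem. Minimize $J(x_1,\dots,x_N)=H(x_1,\dots,x_N)+\sum_{i=1}^N F_i(x_i)$ over $\prod_{i=1}^N\mathbb R^{d_i}$. Assumptions: (A1) $H:\prod_i\mathbb R^{d_i}\to\mathbb R$ is continuously differentiable; for each $i$ and each choice of the other blocks, the partial gradient $x_i\mapsto\nabla_{x_i}H$ is Lipschitz on $\mathbb R^{d_i}$; and $\nabla H$ is Lipschitz on every bounded set. (A2) Each $F_i:\mathbb R^{d_i}\to(-\infty,+\infty]$ (equal to $+\infty$ outside a set $\mathbb D_{F_i}$) is proper, lower semicontinuous and bounded below. (A3) $J$ is a KŁ function, proper, coercive ($J(x)\to+\infty$ as $\|x\|\to\infty$) and bounded below. Subdifferentials and KŁ. The Fréchet subdifferential $\hat\partial f(x)$ of a proper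 lsc $f$ at $x\in\mathrm{dom} f$ is the set of $u$ with $\liminf_{y\to x,y\ne x}\frac{f(y)-f(x)-\langle u,y-x\rangle}{\|y-x\|}\ge0$ (empty if $x\notin\mathrm{dom} f$); the limiting subdifferential is $\partial f(x)=\{u:\exists x^k\to x, f(x^k)\to f(x), u^k\in\hat\partial f(x^k), u^k\to u\}$. A desingularization function is a concave continuous $\phi:[0,\eta)\to\mathbb R_+$ with $\phi(0)=0$, continuously differentiable on $(0,\eta)$ with $\phi'>0$. $f$ is a KŁ function if for every $\bar u$ with $\partial f(\bar u)\neq\emptyset$ there exist $\eta\in(0,+\infty]$, a neighborhood $U$ of $\bar u$ and a desingularization function $\phi$ on $[0,\eta)$ such that $\phi'(f(u)-f(\bar u))\,\mathrm{dist}(0,\partial f(u))\ge1$ for all $u\in U$ with $f(\bar u)<f(u)<f(\bar u)+\eta$. Admissible metrics. For each $i\in[N]$, $\mathcal D_i$ is a family of metrics on $\mathbb R^{d_i}$ such that: (B1) there exist a norm $\|\cdot\|_d$ (on $\mathbb R^{d_i}$) and a constant $C_d>0$ with $C_d\|x-y\|_d\le d(x,y)$ for all $x,y\in\mathbb R^{d_i}$, $d\in\mathcal D_i$; (B2) $d(\cdot,y)$ is convex for every $y\in\mathbb R^{d_i}$, $d\in\mathcal D_i$; (B3) $\omega_i(x,y):=\sup_{d\in\mathcal D_i}d(x,y)$ is bounded on every compact subset of $\mathbb R^{d_i}\times\mathbb R^{d_i}$. iGGBPL algorithm. Input: $x^1_{(N)}=x^0_{(N)}\in\mathrm{dom}\,J$,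 where $x^k_{(N)}=(x_1^k,\dots,x_N^k)$; $\rho_1>0$, $\beta^1=0$, $t_1=1$. For $k=1,2,3,\dots$: (1) Set $y_i^k=x_i^k+\beta^k(x_i^k-x_i^{k-1})$ for all $i$. (2) For $i=1,\dots,N$ successively: put $h_i(c)=H(x_1^{k+1},\dots,x_{i-1}^{k+1},c,x_{i+1}^k,\dots,x_N^k)$; choose any inner product $\langle u,v\rangle_{i,k}=\langle R_{i,k}u,v\rangle$ on $\mathbb R^{d_i}$ ($R_{i,k}$ symmetric positive definite) and any $d_i^k\in\mathcal D_i$; let $L_{i,k}>0$ be a constant such that $h_i(v)\le h_i(u)+\langle R_{i,k}^{-1}\nabla h_i(u),v-u\rangle_{i,k}+\frac{L_{i,k}}2(d_i^k(v,u))^2$ for all $u,v\in\mathbb R^{d_i}$; choose $s_i^k>L_{i,k}$, $\gamma_i^k>1$, $\sigma_i^k=1/(\gamma_i^ks_i^k)$; and choose $$x_i^{k+1}\in\arg\min_{x}\Big[F_i(x)+\tfrac1{2\sigma_i^k}(d_i^k(x,y_i^k))^2+\langle R_{i,k}^{-1}\nabla h_i(y_i^k),x-y_i^k\rangle_{i,k}\Big].$$ (3) If $J(x^{k+1}_{(N)})>J(x^k_{(N)})-\rho_1\sum_i(d_i^k(x_i^{k+1},x_i^k))^2$, set $\beta^k=0$ and redo (1)–(2) once (so that $y_i^k=x_i^k$); the result of this second pass is the final $x^{k+1}_{(N)}$. (4) $t_{k+1}=\frac{1+\sqrt{1+4t_k^2}}2$, $\beta^{k+1}=t_k/t_{k+1}$.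 All quantities with index $k$ refer to the pass that produced the final $x_{(N)}^{k+1}$. *)

theory Defs
  imports "HOL-Analysis.Analysis"
begin

definition lsc_on :: "'a::topological_space set \<Rightarrow> ('a \<Rightarrow> ereal) \<Rightarrow> bool" where
  "lsc_on S f \<longleftrightarrow> (\<forall>x\<in>S. f x \<le> Liminf (at x within S) f)"

definition proper_on :: "'a set \<Rightarrow> ('a \<Rightarrow> ereal) \<Rightarrow> bool" where
  "proper_on S f \<longleftrightarrow> (\<forall>x\<in>S. f x \<noteq> -\<infinity>) \<and> (\<exists>x\<in>S. f x < \<infinity>)"

definition bounded_below_on :: "'a set \<Rightarrow> ('a \<Rightarrow> ereal) \<Rightarrow> bool" where
  "bounded_below_on S f \<longleftrightarrow> (\<exists>m::real. \<forall>x\<in>S. ereal m \<le> f x)"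

definition edom :: "('a \<Rightarrow> ereal) \<Rightarrow> 'a set" where
  "edom f = {x. f x < \<infinity>}"

definition grad :: "('a::real_inner \<Rightarrow> real) \<Rightarrow> 'a \<Rightarrow> 'a" where
  "grad f x = (THE g. GDERIV f x :> g)"

definition frechet_subdiff :: "('a::euclidean_space \<Rightarrow> ereal) \<Rightarrow> 'a \<Rightarrow> 'a set" where
  "frechet_subdiff f x =
     {u. x \<in> edom f \<and>
         0 \<le> Liminf (at x) (\<lambda>y. (f y - f x - ereal (u \<bullet> (y - x))) / ereal (norm (y - x)))}"

definition limiting_subdiff :: "('a::euclidean_space \<Rightarrow> ereal) \<Rightarrow> 'a \<Rightarrow> 'a set" where
  "limiting_subdiff f x =
     {u. \<exists>X U. X \<longlonglongrightarrow> x \<and> (\<lambda>k. f (X k)) \<longlonglongrightarrow> f x \<and>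
               (\<forall>k::nat. U k \<in> frechet_subdiff f (X k)) \<and> U \<longlonglongrightarrow> u}"

definition crit :: "('a::euclidean_space \<Rightarrow> ereal) \<Rightarrow> 'a set" where
  "crit f = {x. 0 \<in> limiting_subdiff f x}"

text \<open>Distance from the origin to a set, equal to \<open>\<infinity>\<close> for the empty set
  (unlike \<^const>\<open>infdist\<close>, which is \<open>0\<close> there).\<close>

definition dist_zero :: "'a::real_normed_vector set \<Rightarrow> ereal" where
  "dist_zero A = (INF v\<in>A. ereal (norm v))"

definition desingularizing :: "ereal \<Rightarrow> (real \<Rightarrow> real) \<Rightarrow> bool" where
  "desingularizing \<eta> \<phi> \<longleftrightarrow>
     concave_on {t. 0 \<le> t \<and> ereal t < \<eta>} \<phi> \<and>
     continuous_on {t. 0 \<le> t \<and> ereal t < \<eta>} \<phi> \<and>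
     (\<forall>t. 0 \<le> t \<and> ereal t < \<eta> \<longrightarrow> 0 \<le> \<phi> t) \<and>
     \<phi> 0 = 0 \<and>
     (\<forall>t. 0 < t \<and> ereal t < \<eta> \<longrightarrow> \<phi> differentiable (at t) \<and> 0 < deriv \<phi> t) \<and>
     continuous_on {t. 0 < t \<and> ereal t < \<eta>} (deriv \<phi>)"

definition KL_function :: "('a::euclidean_space \<Rightarrow> ereal) \<Rightarrow> bool" where
  "KL_function f \<longleftrightarrow>
     (\<forall>a. limiting_subdiff f a \<noteq> {} \<longrightarrow>
       (\<exists>\<eta> U \<phi>. 0 < \<eta> \<and> open U \<and> a \<in> U \<and> desingularizing \<eta> \<phi> \<and>
         (\<forall>u\<in>U. f a < f u \<and> f u < f a + \<eta> \<longrightarrow>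
           1 \<le> ereal (deriv \<phi> (real_of_ereal (f u - f a))) * dist_zero (limiting_subdiff f u))))"

definition cluster_points :: "(nat \<Rightarrow> 'a::topological_space) \<Rightarrow> 'a set" where
  "cluster_points z = {x. \<exists>r. strict_mono r \<and> (z \<circ> r) \<longlonglongrightarrow> x}"

text \<open>The product of \<open>N\<close> Euclidean spaces of arbitrary, possibly different dimensions is
  rendered as \<open>real^'n\<close>, where \<open>'n\<close> indexes all scalar coordinates and \<open>blk j\<close> is the number of
  the block to which coordinate \<open>j\<close> belongs. The \<open>i\<close>-th factor, of dimension
  \<open>card {j. blk j = i}\<close>, is identified with the coordinate subspace \<open>bspace blk i\<close>
  (norm and inner product are inherited).\<close>

definition bspace :: "('n::finite \<Rightarrow> nat) \<Rightarrow> nat \<Rightarrow> (real^'n) set" where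
  "bspace blk i = {x. \<forall>j. blk j \<noteq> i \<longrightarrow> x $ j = 0}"

definition block :: "('n::finite \<Rightarrow> nat) \<Rightarrow> nat \<Rightarrow> real^'n \<Rightarrow> real^'n" where
  "block blk i x = (\<chi> j. if blk j = i then x $ j else 0)"

text \<open>\<open>splice blk i a c b\<close> is the point
  \<open>(a\<^sub>1, \<dots>, a\<^bsub>i-1\<^esub>, c\<^sub>i, b\<^bsub>i+1\<^esub>, \<dots>, b\<^sub>N)\<close>. As it depends on the \<open>i\<close>-th block of \<open>c\<close> only,
  the gradient of \<open>\<lambda>c. H (splice blk i a c b)\<close> lies in \<open>bspace blk i\<close> and is the partial
  gradient of \<open>H\<close> with respect to the \<open>i\<close>-th block.\<close>

definition splice :: "('n::finite \<Rightarrow> nat) \<Rightarrow> nat \<Rightarrow> real^'n \<Rightarrow> real^'n \<Rightarrow> real^'n \<Rightarrow> real^'n" where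
  "splice blk i a c b = (\<chi> j. if blk j < i then a $ j else if blk j = i then c $ j else b $ j)"

definition objective ::
  "nat \<Rightarrow> ('n::finite \<Rightarrow> nat) \<Rightarrow> (real^'n \<Rightarrow> real) \<Rightarrow> (nat \<Rightarrow> real^'n \<Rightarrow> ereal) \<Rightarrow> real^'n \<Rightarrow> ereal" where
  "objective N blk H F x = ereal (H x) + (\<Sum>i=1..N. F i (block blk i x))"

definition smooth_part :: "nat \<Rightarrow> ('n::finite \<Rightarrow> nat) \<Rightarrow> (real^'n \<Rightarrow> real) \<Rightarrow> bool" where
  "smooth_part N blk H \<longleftrightarrow>
     (\<forall>x. H differentiable (at x)) \<and> continuous_on UNIV (grad H) \<and>
     (\<forall>i\<in>{1..N}. \<forall>a. \<exists>L. L-lipschitz_on (bspace blk i) (grad (\<lambda>c. H (splice blk i a c a)))) \<and>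
     (\<forall>B. bounded B \<longrightarrow> (\<exists>L. L-lipschitz_on B (grad H)))"

definition nonsmooth_part ::
  "nat \<Rightarrow> ('n::finite \<Rightarrow> nat) \<Rightarrow> (nat \<Rightarrow> real^'n \<Rightarrow> ereal) \<Rightarrow> bool" where
  "nonsmooth_part N blk F \<longleftrightarrow>
     (\<forall>i\<in>{1..N}. proper_on (bspace blk i) (F i) \<and> lsc_on (bspace blk i) (F i) \<and>
                 bounded_below_on (bspace blk i) (F i))"

definition objective_conditions :: "('a::euclidean_space \<Rightarrow> ereal) \<Rightarrow> bool" where
  "objective_conditions J \<longleftrightarrow>
     KL_function J \<and> proper_on UNIV J \<and> (J \<longlongrightarrow> \<infinity>) at_infinity \<and> bounded_below_on UNIV J"

definition norm_on :: "'a::real_vector set \<Rightarrow> ('a \<Rightarrow> real) \<Rightarrow> bool" where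
  "norm_on E \<nu> \<longleftrightarrow>
     (\<forall>x\<in>E. 0 \<le> \<nu> x \<and> (\<nu> x = 0 \<longleftrightarrow> x = 0)) \<and>
     (\<forall>x\<in>E. \<forall>c. \<nu> (c *\<^sub>R x) = \<bar>c\<bar> * \<nu> x) \<and>
     (\<forall>x\<in>E. \<forall>y\<in>E. \<nu> (x + y) \<le> \<nu> x + \<nu> y)"

text \<open>The norm and the constant in the lower bound are common to all metrics of the family.
  The supremum is taken in \<^typ>\<open>ereal\<close>, so that its finiteness is part of the last condition.\<close>

definition admissible_metrics ::
  "'a::euclidean_space set \<Rightarrow> ('a \<Rightarrow> 'a \<Rightarrow> real) set \<Rightarrow> bool" where
  "admissible_metrics E D \<longleftrightarrow>
     (\<forall>d\<in>D. Metric_space E d) \<and>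
     (\<exists>\<nu> C. norm_on E \<nu> \<and> 0 < C \<and> (\<forall>d\<in>D. \<forall>x\<in>E. \<forall>y\<in>E. C * \<nu> (x - y) \<le> d x y)) \<and>
     (\<forall>d\<in>D. \<forall>y\<in>E. convex_on E (\<lambda>x. d x y)) \<and>
     (\<forall>K. compact K \<and> K \<subseteq> E \<times> E \<longrightarrow>
        (\<exists>M::real. \<forall>(x, y)\<in>K. (SUP d\<in>D. ereal (d x y)) \<le> ereal M))"

definition spd_on :: "'a::euclidean_space set \<Rightarrow> ('a \<Rightarrow> 'a) \<Rightarrow> bool" where
  "spd_on E R \<longleftrightarrow>
     linear R \<and> R ` E \<subseteq> E \<and>
     (\<forall>u\<in>E. \<forall>v\<in>E. R u \<bullet> v = u \<bullet> R v) \<and>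
     (\<forall>u\<in>E. u \<noteq> 0 \<longrightarrow> 0 < R u \<bullet> u)"

definition ip :: "('a::real_inner \<Rightarrow> 'a) \<Rightarrow> 'a \<Rightarrow> 'a \<Rightarrow> real" where
  "ip R u v = R u \<bullet> v"

text \<open>The quantities chosen for one block in one pass: the operator \<open>R\<close> of the inner product,
  the metric, the relative smoothness constant, \<open>s\<close> and \<open>\<gamma>\<close>.\<close>

record 'a choice =
  ch_R :: "'a \<Rightarrow> 'a"
  ch_d :: "'a \<Rightarrow> 'a \<Rightarrow> real"
  ch_L :: real
  ch_s :: real
  ch_gamma :: real

definition ch_sigma :: "'a choice \<Rightarrow> real" where
  "ch_sigma c = 1 / (ch_gamma c * ch_s c)"

text \<open>One block update: \<open>h\<close> is the smooth part as a function of the block, \<open>f\<close> the nonsmooth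
  part, \<open>y\<close> the extrapolated block, \<open>x'\<close> the new block.\<close>

definition block_update ::
  "'a::euclidean_space set \<Rightarrow> ('a \<Rightarrow> 'a \<Rightarrow> real) set \<Rightarrow> ('a \<Rightarrow> real) \<Rightarrow> ('a \<Rightarrow> ereal) \<Rightarrow>
   'a choice \<Rightarrow> 'a \<Rightarrow> 'a \<Rightarrow> bool" where
  "block_update E D h f c y x' \<longleftrightarrow>
     spd_on E (ch_R c) \<and> ch_d c \<in> D \<and> 0 < ch_L c \<and>
     (\<forall>u\<in>E. \<forall>v\<in>E. h v \<le> h u + ip (ch_R c) (inv_into E (ch_R c) (grad h u)) (v - u)
                          + ch_L c / 2 * (ch_d c v u)\<^sup>2) \<and>
     ch_L c < ch_s c \<and> 1 < ch_gamma c \<and>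
     is_arg_min
       (\<lambda>x. f x + ereal (1 / (2 * ch_sigma c) * (ch_d c x y)\<^sup>2
                          + ip (ch_R c) (inv_into E (ch_R c) (grad h y)) (x - y)))
       (\<lambda>x. x \<in> E) x'"

text \<open>One sweep over all blocks, with current iterate \<open>x\<close>, previous iterate \<open>xp\<close>,
  extrapolation parameter \<open>\<beta>\<close> and result \<open>x'\<close>.\<close>

definition pass ::
  "nat \<Rightarrow> ('n::finite \<Rightarrow> nat) \<Rightarrow> (real^'n \<Rightarrow> real) \<Rightarrow> (nat \<Rightarrow> real^'n \<Rightarrow> ereal) \<Rightarrow>
   (nat \<Rightarrow> (real^'n \<Rightarrow> real^'n \<Rightarrow> real) set) \<Rightarrow> real \<Rightarrow> real^'n \<Rightarrow> real^'n \<Rightarrow>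
   (nat \<Rightarrow> (real^'n) choice) \<Rightarrow> real^'n \<Rightarrow> bool" where
  "pass N blk H F D \<beta> xp x c x' \<longleftrightarrow>
     (\<forall>i\<in>{1..N}.
        block_update (bspace blk i) (D i) (\<lambda>v. H (splice blk i x' v x)) (F i) (c i)
          (block blk i (x + \<beta> *\<^sub>R (x - xp))) (block blk i x'))"

definition insufficient_descent ::
  "nat \<Rightarrow> ('n::finite \<Rightarrow> nat) \<Rightarrow> (real^'n \<Rightarrow> real) \<Rightarrow> (nat \<Rightarrow> real^'n \<Rightarrow> ereal) \<Rightarrow> real \<Rightarrow>
   real^'n \<Rightarrow> (nat \<Rightarrow> (real^'n) choice) \<Rightarrow> real^'n \<Rightarrow> bool" where
  "insufficient_descent N blk H F \<rho> x c x' \<longleftrightarrow>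
     objective N blk H F x' >
       objective N blk H F x - ereal (\<rho> * (\<Sum>i=1..N. (ch_d (c i) (block blk i x') (block blk i x))\<^sup>2))"

text \<open>Both sequences start at index \<open>1\<close>; the values at \<open>0\<close> are never used.\<close>

fun t_seq :: "nat \<Rightarrow> real" where
  "t_seq 0 = 1"
| "t_seq (Suc 0) = 1"
| "t_seq (Suc (Suc k)) = (1 + sqrt (1 + 4 * (t_seq (Suc k))\<^sup>2)) / 2"

definition beta_seq :: "nat \<Rightarrow> real" where
  "beta_seq k = (if k \<le> 1 then 0 else t_seq (k - 1) / t_seq k)"

text \<open>\<open>c i k\<close> are the choices for block \<open>i\<close> in the pass that produced the final \<open>z (k + 1)\<close>.
  In the second disjunct, \<open>w\<close> and \<open>e\<close> are the result and the choices of a discarded first pass.\<close>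

definition iGGBPL ::
  "nat \<Rightarrow> ('n::finite \<Rightarrow> nat) \<Rightarrow> (real^'n \<Rightarrow> real) \<Rightarrow> (nat \<Rightarrow> real^'n \<Rightarrow> ereal) \<Rightarrow>
   (nat \<Rightarrow> (real^'n \<Rightarrow> real^'n \<Rightarrow> real) set) \<Rightarrow> real \<Rightarrow>
   (nat \<Rightarrow> nat \<Rightarrow> (real^'n) choice) \<Rightarrow> (nat \<Rightarrow> real^'n) \<Rightarrow> bool" where
  "iGGBPL N blk H F D \<rho> c z \<longleftrightarrow>
     0 < \<rho> \<and> z 0 = z 1 \<and> z 1 \<in> edom (objective N blk H F) \<and>
     (\<forall>k\<ge>1.
        pass N blk H F D (beta_seq k) (z (k - 1)) (z k) (\<lambda>i. c i k) (z (k + 1)) \<and>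
        \<not> insufficient_descent N blk H F \<rho> (z k) (\<lambda>i. c i k) (z (k + 1))
      \<or>
        (\<exists>e w. pass N blk H F D (beta_seq k) (z (k - 1)) (z k) e w \<and>
               insufficient_descent N blk H F \<rho> (z k) e w) \<and>
        pass N blk H F D 0 (z (k - 1)) (z k) (\<lambda>i. c i k) (z (k + 1)))"

end

theory Submission
  imports Defs
begin

text \<open>The block updates of one pass, summed over the blocks, say that the new iterate \<open>p\<close> almost
  minimises \<open>\<Phi>(x) + g \<bullet> x\<close> near the extrapolated point \<open>y\<close>, up to an error \<open>K * norm (x - y)\<^sup>2\<close>; here
  \<open>\<Phi>\<close> is the nonsmooth part and \<open>g\<close> collects the partial gradients. That \<open>K\<close> does not depend on the
  pass comes from the convexity of the metrics. Sufficient descent makes consecutive iterates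
  approach each other, so along a subsequence converging to \<open>l\<close> also \<open>y\<close> tends to \<open>l\<close> and \<open>g\<close> to the
  gradient of the smooth part at \<open>l\<close>. Testing with \<open>x = l\<close> gives convergence of the
  objective values. For criticality, no sum rule for subdifferentials is needed: a minimiser \<open>q\<close> of
  \<open>\<Phi>(x) + g \<bullet> x + 2 * K * norm (x - y)\<^sup>2\<close> on the unit ball around \<open>y\<close> lies close to \<open>y\<close>, and the
  objective has a small Frechet subgradient at \<open>q\<close>.\<close>

subsection \<open>Lower semicontinuity\<close>

lemma lsc_on_iff: "lsc_on S f \<longleftrightarrow> (\<forall>x\<in>S. \<forall>a<f x. \<forall>\<^sub>F y in at x within S. a < f y)"
  unfolding lsc_on_def le_Liminf_iff by blast

lemma lsc_on_add:
  fixes f g :: "'a::topological_space \<Rightarrow> ereal"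
  assumes f: "lsc_on S f" and g: "lsc_on S g"
    and nf: "\<forall>x\<in>S. f x \<noteq> -\<infinity>" and ng: "\<forall>x\<in>S. g x \<noteq> -\<infinity>"
  shows "lsc_on S (\<lambda>x. f x + g x)"
  unfolding lsc_on_iff
proof (intro ballI allI impI)
  fix x a assume x: "x \<in> S" and a: "a < f x + g x"
  \<comment> \<open>The level \<open>a\<close> is split into one level below each summand. If both
    values are finite, each is lowered by half of the gap \<open>u + v - r\<close>; an infinite
    summand takes up whatever the other one leaves.\<close>
  have "\<exists>b c. b < f x \<and> c < g x \<and> a \<le> b + c"
  proof (cases a)
    case (real r)
    show ?thesis
    proof (cases "f x")
      case fr: (real u)
      show ?thesis
      proof (cases "g x")
        case (real v)
        with fr a \<open>a = ereal r\<close> show ?thesis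
          by (intro exI[of _ "ereal (u - (u + v - r) / 2)"] exI[of _ "ereal (v - (u + v - r) / 2)"])
             (auto simp: field_simps)
      next
        case PInf
        with fr \<open>a = ereal r\<close> show ?thesis
          by (intro exI[of _ "ereal (u - 1)"] exI[of _ "ereal (r - u + 1)"]) auto
      qed (use ng x in auto)
    next
      case PInf
      show ?thesis
      proof (cases "g x")
        case (real v)
        with PInf \<open>a = ereal r\<close> show ?thesis
          by (intro exI[of _ "ereal (r - v + 1)"] exI[of _ "ereal (v - 1)"]) auto
      next
        case gP: PInf
        with PInf \<open>a = ereal r\<close> show ?thesis
          by (intro exI[of _ "ereal r"] exI[of _ "ereal 0"]) auto
      qed (use ng x in auto)
    qed (use nf x in auto)
  qed (use a nf ng x in \<open>auto intro!: exI[of _ "-\<infinity>"] simp: less_le\<close>)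
  then obtain b c where "b < f x" "c < g x" "a \<le> b + c" by blast
  then have "\<forall>\<^sub>F y in at x within S. b < f y" "\<forall>\<^sub>F y in at x within S. c < g y"
    using f g x unfolding lsc_on_iff by blast+
  then show "\<forall>\<^sub>F y in at x within S. a < f y + g y"
    by eventually_elim (meson \<open>a \<le> b + c\<close> ereal_add_strict_mono2 le_less_trans)
qed

lemma sum_ereal_not_MInfty:
  fixes f :: "'b \<Rightarrow> ereal"
  assumes "\<And>i. i \<in> I \<Longrightarrow> f i \<noteq> -\<infinity>"
  shows "sum f I \<noteq> -\<infinity>"
  using assms by (induction I rule: infinite_finite_induct) auto

lemma lsc_on_sum:
  fixes f :: "'b \<Rightarrow> 'a::topological_space \<Rightarrow> ereal"
  assumes "\<And>i. i \<in> I \<Longrightarrow> lsc_on S (f i)" "\<And>i x. i \<in> I \<Longrightarrow> x \<in> S \<Longrightarrow> f i x \<noteq> -\<infinity>"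
  shows "lsc_on S (\<lambda>x. \<Sum>i\<in>I. f i x)"
  using assms
proof (induction I rule: infinite_finite_induct)
  case (insert i I)
  then show ?case
    by (auto intro!: lsc_on_add sum_ereal_not_MInfty)
qed (auto simp: lsc_on_iff)

lemma lsc_on_compose:
  assumes f: "lsc_on T f" and g: "continuous_on S g" "g ` S \<subseteq> T"
  shows "lsc_on S (\<lambda>x. f (g x))"
  unfolding lsc_on_iff
proof (intro ballI allI impI)
  fix x a assume x: "x \<in> S" and a: "a < f (g x)"
  then have "\<forall>\<^sub>F y in at (g x) within T. a < f y"
    using f g unfolding lsc_on_iff by blast
  then obtain U where U: "open U" "g x \<in> U" "\<And>y. y \<in> U \<Longrightarrow> y \<noteq> g x \<Longrightarrow> y \<in> T \<Longrightarrow> a < f y"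
    unfolding eventually_at_topological by blast
  have "(g \<longlongrightarrow> g x) (at x within S)"
    using g x by (auto simp: continuous_on_def)
  then have "\<forall>\<^sub>F y in at x within S. g y \<in> U"
    using U topological_tendstoD by blast
  moreover have "\<forall>\<^sub>F y in at x within S. y \<in> S"
    by (simp add: eventually_at_filter)
  ultimately show "\<forall>\<^sub>F y in at x within S. a < f (g y)"
  proof eventually_elim
    case (elim y)
    \<comment> \<open>The neighbourhood \<open>U\<close> controls \<open>f\<close> only away from
      \<open>g x\<close>, so points with \<open>g y = g x\<close> are settled by
      \<open>a < f (g x)\<close> instead.\<close>
    show ?case
    proof (cases "g y = g x")
      case False
      then show ?thesis using U elim g(2) by blast
    qed (use a in simp)
  qed
qed

lemma lsc_on_continuous:
  fixes g :: "'a::topological_space \<Rightarrow> real"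
  assumes "continuous_on S g"
  shows "lsc_on S (\<lambda>x. ereal (g x))"
  unfolding lsc_on_iff
proof (intro ballI allI impI)
  fix x a assume "x \<in> S" "a < ereal (g x)"
  moreover have "((\<lambda>x. ereal (g x)) \<longlongrightarrow> ereal (g x)) (at x within S)"
    using assms \<open>x \<in> S\<close> by (auto simp: continuous_on_def)
  ultimately show "\<forall>\<^sub>F y in at x within S. a < ereal (g y)"
    using order_tendstoD(1) by blast
qed

lemma lsc_on_liminf:
  assumes f: "lsc_on S f" and X: "X \<longlonglongrightarrow> x" "\<forall>n. X n \<in> S" "x \<in> S"
  shows "f x \<le> liminf (\<lambda>n. f (X n))"
  unfolding le_Liminf_iff
proof (intro allI impI)
  fix a assume a: "a < f x"
  then have "\<forall>\<^sub>F y in at x within S. a < f y"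
    using f X unfolding lsc_on_iff by blast
  then obtain U where U: "open U" "x \<in> U" "\<And>y. y \<in> U \<Longrightarrow> y \<noteq> x \<Longrightarrow> y \<in> S \<Longrightarrow> a < f y"
    unfolding eventually_at_topological by blast
  have "\<forall>\<^sub>F n in sequentially. X n \<in> U"
    using X U topological_tendstoD by blast
  then show "\<forall>\<^sub>F n in sequentially. a < f (X n)"
    by eventually_elim (use U X a in metis)
qed

text \<open>The direct method: a minimising sequence has a subsequence converging in
  \<open>K\<close>, and lower semicontinuity keeps the value at its limit from exceeding the
  infimum.\<close>

lemma lsc_on_attains_inf:
  fixes f :: "'a::metric_space \<Rightarrow> ereal"
  assumes f: "lsc_on K f" and K: "compact K" "K \<noteq> {}"
  shows "\<exists>q\<in>K. \<forall>x\<in>K. f q \<le> f x"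
proof -
  obtain u where u: "\<And>n. u n \<in> f ` K" "u \<longlonglongrightarrow> Inf (f ` K)"
    using Inf_as_limit[of "f ` K"] K by blast
  then have "\<forall>n. \<exists>x\<in>K. u n = f x" by blast
  then obtain X where X: "\<And>n. X n \<in> K" "\<And>n. u n = f (X n)" by metis
  obtain q r where q: "q \<in> K" "strict_mono r" "(X \<circ> r) \<longlonglongrightarrow> q"
    using K X unfolding compact_def by blast
  have "f q \<le> liminf (\<lambda>n. f ((X \<circ> r) n))"
    using X q by (intro lsc_on_liminf[OF f]) (auto simp: o_def)
  also have "(\<lambda>n. f ((X \<circ> r) n)) \<longlonglongrightarrow> Inf (f ` K)"
    using LIMSEQ_subseq_LIMSEQ[OF u(2) q(2)] by (simp add: o_def X(2))
  then have "liminf (\<lambda>n. f ((X \<circ> r) n)) = Inf (f ` K)"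
    by (intro lim_imp_Liminf) auto
  finally show ?thesis
    using q(1) by (meson INF_lower order_trans)
qed

subsection \<open>Gradients, metrics and inner products\<close>

text \<open>\<open>grad\<close> is a definite description, so both existence and uniqueness have to
  be shown. Existence is the Riesz representation of the derivative in the standard basis.\<close>

lemma GDERIV_grad:
  fixes H :: "'a::euclidean_space \<Rightarrow> real"
  assumes "H differentiable (at x)"
  shows "GDERIV H x :> grad H x"
proof -
  obtain H' where H': "(H has_derivative H') (at x)"
    using assms differentiable_def by blast
  then have lin: "linear H'"
    by (rule has_derivative_linear)
  define g where "g = (\<Sum>b\<in>Basis. H' b *\<^sub>R b)"
  have "H' h = h \<bullet> g" for h
  proof -
    have "H' h = H' (\<Sum>b\<in>Basis. (h \<bullet> b) *\<^sub>R b)"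
      by (simp only: euclidean_representation)
    also have "\<dots> = h \<bullet> g"
      by (simp add: linear_sum[OF lin] linear_cmul[OF lin] g_def inner_sum_right mult.commute)
    finally show ?thesis .
  qed
  then have "H' = (\<lambda>h. h \<bullet> g)" by auto
  with H' have g: "GDERIV H x :> g"
    by (simp add: gderiv_def)
  show ?thesis
    unfolding grad_def
  proof (rule theI[of "gderiv H x" g, OF g])
    fix g' assume "GDERIV H x :> g'"
    then have "(\<lambda>h. h \<bullet> g') = (\<lambda>h. h \<bullet> g)"
      using g unfolding gderiv_def by (rule has_derivative_unique)
    then have "\<forall>h. h \<bullet> g' = h \<bullet> g" by meson
    then show "g' = g"
      by (simp only: vector_eq_ldot)
  qed
qed

lemma grad_eqI:
  fixes H :: "'a::euclidean_space \<Rightarrow> real"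
  assumes "GDERIV H x :> g"
  shows "grad H x = g"
proof -
  have "H differentiable (at x)"
    using assms unfolding gderiv_def differentiable_def by blast
  then have "(\<lambda>h. h \<bullet> grad H x) = (\<lambda>h. h \<bullet> g)"
    using assms GDERIV_grad[of H x] unfolding gderiv_def by (intro has_derivative_unique)
  then have "\<forall>h. h \<bullet> grad H x = h \<bullet> g" by meson
  then show ?thesis
    by (simp only: vector_eq_ldot)
qed

text \<open>Equivalence of norms in finite dimension: an orthonormal basis of \<open>E\<close> shows
  that \<open>\<nu>\<close> is Lipschitz for the Euclidean norm, so it has a positive minimum on the
  unit sphere of \<open>E\<close>; homogeneity does the rest.\<close>

lemma norm_on_ge_norm:
  fixes E :: "'a::euclidean_space set"
  assumes E: "subspace E" and \<nu>: "norm_on E \<nu>"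
  shows "\<exists>c>0. \<forall>x\<in>E. c * norm x \<le> \<nu> x"
proof -
  have nonneg: "0 \<le> \<nu> x" and eq_0: "\<nu> x = 0 \<longleftrightarrow> x = 0" and scale: "\<nu> (c *\<^sub>R x) = \<bar>c\<bar> * \<nu> x" if "x \<in> E" for x c
    using \<nu> that unfolding norm_on_def by blast+
  have tri: "\<nu> (x + y) \<le> \<nu> x + \<nu> y" if "x \<in> E" "y \<in> E" for x y
    using \<nu> that unfolding norm_on_def by blast
  obtain B where B: "B \<subseteq> E" "pairwise orthogonal B" "\<And>x. x \<in> B \<Longrightarrow> norm x = 1" "independent B" "span B = E"
    using orthonormal_basis_subspace[OF E] by metis
  have finB: "finite B" using B(4) by (rule independent_imp_finite)
  define M where "M = (\<Sum>b\<in>B. \<nu> b)"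
  have sum_le: "(\<Sum>b\<in>A. f b *\<^sub>R b) \<in> E \<and> \<nu> (\<Sum>b\<in>A. f b *\<^sub>R b) \<le> (\<Sum>b\<in>A. \<bar>f b\<bar> * \<nu> b)" if "A \<subseteq> B" for A f
    using finite_subset[OF that finB] that
  proof (induction A rule: finite_induct)
    case empty
    then show ?case using eq_0[of 0] subspace_0[OF E] by simp
  next
    case (insert b A)
    then have "b \<in> E" using B by auto
    then have "f b *\<^sub>R b \<in> E" using E by (simp add: subspace_scale)
    then show ?case
      using insert tri[of "f b *\<^sub>R b" "\<Sum>b\<in>A. f b *\<^sub>R b"] scale[OF \<open>b \<in> E\<close>, of "f b"] E
      by (auto simp: subspace_add)
  qed
  have le: "\<nu> x \<le> M * norm x" if "x \<in> E" for x
  proof -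
    have "x = (\<Sum>b\<in>B. (x \<bullet> b) *\<^sub>R b)"
      using orthonormal_basis_expand[of B x] B finB that by auto
    then have "\<nu> x \<le> (\<Sum>b\<in>B. \<bar>x \<bullet> b\<bar> * \<nu> b)"
      using sum_le[of B "\<lambda>b. x \<bullet> b"] by auto
    also have "\<dots> \<le> (\<Sum>b\<in>B. norm x * \<nu> b)"
    proof (intro sum_mono mult_right_mono)
      fix b assume "b \<in> B"
      then show "\<bar>x \<bullet> b\<bar> \<le> norm x" "0 \<le> \<nu> b"
        using Cauchy_Schwarz_ineq2[of x b] B nonneg by auto
    qed
    finally show ?thesis by (simp add: M_def sum_distrib_left mult.commute)
  qed
  have diff: "\<nu> x - \<nu> y \<le> M * norm (x - y)" if "x \<in> E" "y \<in> E" for x y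
    using tri[of "x - y" y] le[of "x - y"] that E by (auto simp: subspace_diff)
  have "\<bar>\<nu> x - \<nu> y\<bar> \<le> M * norm (x - y)" if "x \<in> E" "y \<in> E" for x y
    using diff[OF that] diff[OF that(2,1)] by (simp add: norm_minus_commute abs_le_iff)
  moreover have "0 \<le> M" unfolding M_def using B nonneg by (auto intro: sum_nonneg)
  ultimately have "M-lipschitz_on E \<nu>"
    by (auto simp: lipschitz_on_def dist_norm)
  then have cont: "continuous_on (E \<inter> sphere 0 1) \<nu>"
    by (meson continuous_on_subset inf_le1 lipschitz_on_continuous_on)
  have comp: "compact (E \<inter> sphere 0 1)"
    using closed_subspace[OF E] by (simp add: closed_Int_compact)
  obtain c where c: "0 < c" "\<And>x. x \<in> E \<Longrightarrow> norm x = 1 \<Longrightarrow> c \<le> \<nu> x"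
  proof (cases "E \<inter> sphere 0 1 = {}")
    case True
    then have "\<And>x. x \<in> E \<Longrightarrow> norm x \<noteq> 1" by auto
    then show ?thesis using that[of 1] by auto
  next
    case False
    from continuous_attains_inf[OF comp this cont] obtain x where
      x: "x \<in> E" "norm x = 1" "\<And>y. y \<in> E \<Longrightarrow> norm y = 1 \<Longrightarrow> \<nu> x \<le> \<nu> y" by auto
    moreover have "0 < \<nu> x" using x eq_0[of x] nonneg[of x] by force
    ultimately show ?thesis using that by blast
  qed
  have "c * norm x \<le> \<nu> x" if "x \<in> E" for x
  proof (cases "x = 0")
    case False
    then have "c \<le> \<nu> ((1 / norm x) *\<^sub>R x)"
      using that E by (intro c) (auto simp: subspace_scale)
    with False that show ?thesis by (subst (asm) scale) (auto simp: field_simps)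
  qed (use that nonneg in auto)
  with c(1) show ?thesis by blast
qed

text \<open>Convexity of \<open>d(-, y)\<close> along the segment from \<open>y\<close> to a point at distance \<open>1\<close> turns the
  bound on compact sets into a linear bound near the diagonal.\<close>

lemma admissible_metrics_le_norm:
  assumes E: "subspace E" and D: "admissible_metrics E D"
  shows "\<exists>M\<ge>0. \<forall>d\<in>D. \<forall>x\<in>E. \<forall>y\<in>E. norm y \<le> r \<longrightarrow> norm (x - y) \<le> 1 \<longrightarrow> d x y \<le> M * norm (x - y)"
proof -
  have met: "\<And>d. d \<in> D \<Longrightarrow> Metric_space E d" and conv: "\<And>d y. d \<in> D \<Longrightarrow> y \<in> E \<Longrightarrow> convex_on E (\<lambda>x. d x y)"
    using D unfolding admissible_metrics_def by blast+
  \<comment> \<open>The radius \<open>r + 1\<close> makes room for the far end \<open>p\<close> of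
    the segment. As \<open>K\<close> depends on neither the metric nor the points, one bound serves
    all of \<open>D\<close>.\<close>
  define K where "K = (E \<inter> cball 0 (r + 1)) \<times> (E \<inter> cball 0 r)"
  have "compact K" "K \<subseteq> E \<times> E"
    unfolding K_def using closed_subspace[OF E]
    by (auto intro!: compact_Times closed_Int_compact)
  then obtain M where "\<forall>(x, y)\<in>K. (SUP d\<in>D. ereal (d x y)) \<le> ereal M"
    using D unfolding admissible_metrics_def by meson
  then have M: "d x y \<le> M" if "(x, y) \<in> K" "d \<in> D" for x y d
    using that by (fastforce simp: SUP_le_iff)
  \<comment> \<open>The maximum guards against a negative \<open>M\<close>, possible when
    \<open>D\<close> or \<open>K\<close> is empty.\<close>
  have "d x y \<le> max M 0 * norm (x - y)"
    if d: "d \<in> D" and xy: "x \<in> E" "y \<in> E" "norm y \<le> r" "norm (x - y) \<le> 1" for d x y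
  proof (cases "x = y")
    case True
    with met[OF d] xy show ?thesis by (simp add: Metric_space.mdist_zero)
  next
    case False
    define e where "e = norm (x - y)"
    define p where "p = y + (1 / e) *\<^sub>R (x - y)"
    have e: "0 < e" "e \<le> 1" using False xy by (auto simp: e_def)
    have p: "p \<in> E" unfolding p_def using E xy by (simp add: subspace_add subspace_diff subspace_scale)
    have "norm p \<le> norm y + norm ((1 / e) *\<^sub>R (x - y))"
      unfolding p_def by (rule norm_triangle_ineq)
    also have "norm ((1 / e) *\<^sub>R (x - y)) = 1" using False by (simp add: e_def)
    finally have "(p, y) \<in> K" using xy p by (auto simp: K_def)
    have "x = (1 - e) *\<^sub>R y + e *\<^sub>R p"
      using e by (simp add: p_def algebra_simps)
    then have "d x y \<le> (1 - e) * d y y + e * d p y"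
      using convex_onD[OF conv[OF d xy(2)], of e y p] e xy p by auto
    also have "\<dots> \<le> e * max M 0"
      using Metric_space.mdist_zero[OF met[OF d] xy(2)] M[OF \<open>(p, y) \<in> K\<close> d] e
      by (simp add: le_max_iff_disj)
    finally show ?thesis by (simp add: e_def mult.commute)
  qed
  then show ?thesis
    by (intro exI[of _ "max M 0"]) auto
qed

lemma admissible_metrics_ge_norm:
  assumes E: "subspace E" and D: "admissible_metrics E D"
  shows "\<exists>c>0. \<forall>d\<in>D. \<forall>x\<in>E. \<forall>y\<in>E. c * norm (x - y) \<le> d x y"
proof -
  obtain \<nu> C where \<nu>: "norm_on E \<nu>" "0 < C" "\<forall>d\<in>D. \<forall>x\<in>E. \<forall>y\<in>E. C * \<nu> (x - y) \<le> d x y"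
    using D unfolding admissible_metrics_def by metis
  obtain c where c: "c > 0" "\<forall>x\<in>E. c * norm x \<le> \<nu> x"
    using norm_on_ge_norm[OF E \<nu>(1)] by blast
  have "C * c * norm (x - y) \<le> d x y" if "d \<in> D" "x \<in> E" "y \<in> E" for d x y
  proof -
    have "x - y \<in> E" using that E by (simp add: subspace_diff)
    then have "C * (c * norm (x - y)) \<le> C * \<nu> (x - y)"
      using c \<nu>(2) by (simp add: mult_left_mono)
    also have "\<dots> \<le> d x y" using \<nu> that by blast
    finally show ?thesis by simp
  qed
  moreover have "0 < C * c" using \<nu>(2) c(1) by simp
  ultimately show ?thesis by blast
qed

text \<open>Positive definiteness makes \<open>R\<close> injective on \<open>E\<close>, and a
  dimension count makes it onto, so \<open>R\<close> undoes its inverse. Thereby the choice of inner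
  product cancels from the linear terms of the algorithm.\<close>

lemma ip_inv_into:
  fixes E :: "'a::euclidean_space set"
  assumes R: "spd_on E R" and E: "subspace E" and g: "g \<in> E"
  shows "ip R (inv_into E R g) v = g \<bullet> v"
proof -
  have lin: "linear R" and RE: "R ` E \<subseteq> E" and pos: "\<And>u. u \<in> E \<Longrightarrow> u \<noteq> 0 \<Longrightarrow> 0 < R u \<bullet> u"
    using R unfolding spd_on_def by auto
  have "inj_on R E"
    using pos by (subst linear_injective_on_subspace_0[OF lin E]) (metis inner_zero_left less_irrefl)
  then have "dim (R ` E) = dim E"
    using lin E by (intro dim_image_eq) (simp_all add: span_eq_iff[THEN iffD2, OF E])
  then have "R ` E = E"
    by (intro subspace_dim_equal) (use RE E lin in \<open>auto intro: linear_subspace_image\<close>)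
  then have "R (inv_into E R g) = g"
    using g by (intro f_inv_into_f) auto
  then show ?thesis by (simp add: ip_def)
qed

subsection \<open>Limits of approximate minimisers\<close>

text \<open>The penalty factor \<open>2 * K\<close> is twice the allowed error, so comparing
  \<open>q\<close> with \<open>p\<close> leaves a surplus of
  \<open>K * (norm (q - y))\<^sup>2\<close>, which forces \<open>q\<close> close to
  \<open>y\<close>. Fermat's rule at \<open>q\<close> then yields the subgradient, in which
  \<open>(4 * K) *\<^sub>R (q - y)\<close> is the gradient of the penalty.\<close>

lemma frechet_subdiff_near_minimiser:
  fixes \<Phi> :: "'a::euclidean_space \<Rightarrow> ereal" and H :: "'a \<Rightarrow> real"
  assumes H: "\<And>x. GDERIV H x :> grad H x"
    and lsc: "lsc_on UNIV \<Phi>" and proper: "\<And>x. \<Phi> x \<noteq> -\<infinity>"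
    and p: "\<Phi> p < \<infinity>" "norm (p - y) < 1 / 2" and K: "0 < K"
    and le: "\<And>x. norm (x - y) \<le> 1 \<Longrightarrow> \<Phi> p \<le> \<Phi> x + ereal (g \<bullet> (x - p) + K * (norm (x - y))\<^sup>2)"
  obtains q where "norm (q - y) \<le> 2 * norm (p - y)"
    "\<Phi> q \<le> \<Phi> p + ereal (g \<bullet> (p - q) + 2 * K * (norm (p - y))\<^sup>2)"
    "grad H q - g - (4 * K) *\<^sub>R (q - y) \<in> frechet_subdiff (\<lambda>x. ereal (H x) + \<Phi> x) q"
proof -
  have "lsc_on (cball y 1) (\<lambda>x. \<Phi> x + ereal (g \<bullet> x + 2 * K * (norm (x - y))\<^sup>2))"
    using proper
    by (intro lsc_on_add lsc_on_compose[OF lsc, of _ "\<lambda>x. x"] lsc_on_continuous continuous_intros) auto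
  then obtain q where q: "q \<in> cball y 1"
    and q_min: "\<And>x. x \<in> cball y 1 \<Longrightarrow> \<Phi> q + ereal (g \<bullet> q + 2 * K * (norm (q - y))\<^sup>2)
                                   \<le> \<Phi> x + ereal (g \<bullet> x + 2 * K * (norm (x - y))\<^sup>2)"
    using lsc_on_attains_inf[of "cball y 1"] by fastforce
  obtain a where a: "\<Phi> p = ereal a" using p proper[of p] by (cases "\<Phi> p") auto
  have pc: "p \<in> cball y 1" using p by (simp add: dist_norm norm_minus_commute)
  have qp: "\<Phi> q + ereal (g \<bullet> q + 2 * K * (norm (q - y))\<^sup>2) \<le> ereal (a + (g \<bullet> p + 2 * K * (norm (p - y))\<^sup>2))"
    using q_min[OF pc] a by simp
  then obtain b where b: "\<Phi> q = ereal b" using proper[of q] by (cases "\<Phi> q") auto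
  have ba: "b + g \<bullet> q + 2 * K * (norm (q - y))\<^sup>2 \<le> a + g \<bullet> p + 2 * K * (norm (p - y))\<^sup>2"
    using qp b by simp
  \<comment> \<open>Approximate minimality of \<open>p\<close> meets minimality of \<open>q\<close>:
    the linear terms cancel, and half of the penalty at \<open>q\<close> survives.\<close>
  have "a \<le> b + (g \<bullet> (q - p) + K * (norm (q - y))\<^sup>2)"
    using le[of q] q a b by (simp add: dist_norm norm_minus_commute)
  then have "K * (norm (q - y))\<^sup>2 \<le> K * (2 * (norm (p - y))\<^sup>2)"
    using ba by (simp add: inner_diff_right algebra_simps)
  then have *: "(norm (q - y))\<^sup>2 \<le> 2 * (norm (p - y))\<^sup>2" using K by simp
  also have "\<dots> \<le> (2 * norm (p - y))\<^sup>2" by (simp add: power2_eq_square)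
  finally have 1: "norm (q - y) \<le> 2 * norm (p - y)"
    by (rule power2_le_imp_le) simp
  \<comment> \<open>Here \<open>norm (p - y) < 1 / 2\<close> pays off: \<open>q\<close> is in the
    open ball, hence an unconstrained local minimiser.\<close>
  then have q': "q \<in> ball y 1" using p by (simp add: dist_norm norm_minus_commute)
  have 2: "\<Phi> q \<le> \<Phi> p + ereal (g \<bullet> (p - q) + 2 * K * (norm (p - y))\<^sup>2)"
  proof -
    have "0 \<le> 2 * K * (norm (q - y))\<^sup>2" using K by simp
    then have "b \<le> a + (g \<bullet> (p - q) + 2 * K * (norm (p - y))\<^sup>2)"
      using ba unfolding inner_diff_right by linarith
    then show ?thesis using a b by simp
  qed
  define u where "u = grad H q - g - (4 * K) *\<^sub>R (q - y)"
  define J where "J = (\<lambda>x. ereal (H x) + \<Phi> x)"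
  \<comment> \<open>A lower bound for the Frechet difference quotient: the first-order remainder of
    \<open>H\<close>, minus what the penalty contributes beyond its linear part at \<open>q\<close>.
    Both parts tend to \<open>0\<close>.\<close>
  define e where "e = (\<lambda>x. (H x - H q - (x - q) \<bullet> grad H q) / norm (x - q) - 2 * K * norm (x - q))"
  have "((\<lambda>x. (H x - H q - (x - q) \<bullet> grad H q) / norm (x - q)) \<longlongrightarrow> 0) (at q)"
    using H[of q] unfolding gderiv_def has_derivative_iff_norm
    by (subst tendsto_norm_zero_iff[symmetric]) (simp add: norm_divide)
  moreover have "((\<lambda>x. 2 * K * norm (x - q)) \<longlongrightarrow> 2 * K * norm (q - q)) (at q)"
    by (intro tendsto_intros)
  ultimately have "(e \<longlongrightarrow> 0 - 2 * K * norm (q - q)) (at q)"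
    unfolding e_def by (rule tendsto_diff)
  then have "((\<lambda>x. ereal (e x)) \<longlongrightarrow> ereal 0) (at q)" by simp
  then have "Liminf (at q) (\<lambda>x. ereal (e x)) = 0"
    by (intro lim_imp_Liminf) (auto simp: zero_ereal_def)
  moreover have "Liminf (at q) (\<lambda>x. ereal (e x))
    \<le> Liminf (at q) (\<lambda>x. (J x - J q - ereal (u \<bullet> (x - q))) / ereal (norm (x - q)))"
  proof (rule Liminf_mono)
    have "\<forall>\<^sub>F x in at q. x \<in> ball y 1"
      using q' by (intro eventually_at_in_open') auto
    moreover have "\<forall>\<^sub>F x in at q. x \<noteq> q" by (simp add: eventually_at_filter)
    ultimately show "\<forall>\<^sub>F x in at q. ereal (e x) \<le> (J x - J q - ereal (u \<bullet> (x - q))) / ereal (norm (x - q))"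
    proof eventually_elim
      case (elim x)
      then have pos: "0 < norm (x - q)" by simp
      show ?case
      proof (cases "\<Phi> x")
        case (real c)
        have "b + (g \<bullet> q + 2 * K * (norm (q - y))\<^sup>2) \<le> c + (g \<bullet> x + 2 * K * (norm (x - y))\<^sup>2)"
          using q_min[of x] elim b real by auto
        moreover have "(norm (x - y))\<^sup>2 = (norm (q - y))\<^sup>2 + 2 * ((q - y) \<bullet> (x - q)) + (norm (x - q))\<^sup>2"
          unfolding power2_norm_eq_inner by (simp add: inner_diff_left inner_diff_right inner_commute)
        ultimately have "- (g \<bullet> (x - q)) - 4 * K * ((q - y) \<bullet> (x - q)) - 2 * K * (norm (x - q))\<^sup>2 \<le> c - b"
          by (simp add: inner_diff_right algebra_simps)
        then have "H x - H q - (x - q) \<bullet> grad H q - 2 * K * norm (x - q) * norm (x - q)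
            \<le> H x + c - (H q + b) - u \<bullet> (x - q)"
          unfolding u_def inner_diff_left[of _ _ "x - q"] inner_scaleR_left
          by (simp add: inner_commute[of "x - q"] power2_eq_square)
        moreover have "e x = (H x - H q - (x - q) \<bullet> grad H q - 2 * K * norm (x - q) * norm (x - q)) / norm (x - q)"
          unfolding e_def using pos by (simp add: diff_divide_distrib)
        ultimately have "e x \<le> (H x + c - (H q + b) - u \<bullet> (x - q)) / norm (x - q)"
          using pos by (simp add: divide_right_mono)
        then show ?thesis
          using real b pos by (simp add: J_def)
      next
        case PInf
        then show ?thesis
          using b pos by (simp add: J_def)
      qed (use proper in auto)
    qed
  qed
  ultimately have "u \<in> frechet_subdiff J q"
    unfolding frechet_subdiff_def edom_def using b by (simp add: J_def)
  then show ?thesis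
    using that 1 2 unfolding u_def J_def by blast
qed

text \<open>Lower semicontinuity supplies the lower half of the convergence, so only an upper
  estimate has to be found.\<close>

lemma lsc_on_tendsto:
  fixes f :: "'a::topological_space \<Rightarrow> ereal"
  assumes "lsc_on UNIV f" "X \<longlonglongrightarrow> x" "\<forall>\<^sub>F n in sequentially. f (X n) \<le> b n" "b \<longlonglongrightarrow> f x"
  shows "(\<lambda>n. f (X n)) \<longlonglongrightarrow> f x"
proof (rule order_tendstoI)
  fix a assume "a < f x"
  with lsc_on_liminf[OF assms(1,2)] show "\<forall>\<^sub>F n in sequentially. a < f (X n)"
    by (simp add: le_Liminf_iff)
next
  fix a assume "f x < a"
  with assms(4) have "\<forall>\<^sub>F n in sequentially. b n < a" by (rule order_tendstoD)
  with assms(3) show "\<forall>\<^sub>F n in sequentially. f (X n) < a" by eventually_elim simp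
qed

text \<open>The limit passage, stated apart from blocks and metrics. The bound \<open>C\<close>
  keeps \<open>\<Phi>\<close> finite along \<open>p\<close> and, by lower semicontinuity, at
  \<open>l\<close>, so that extended real sums pass to the limit.\<close>

lemma approx_minimisers_limit:
  fixes \<Phi> :: "'a::euclidean_space \<Rightarrow> ereal" and H :: "'a \<Rightarrow> real"
  assumes H: "\<And>x. GDERIV H x :> grad H x" and H': "continuous_on UNIV (grad H)"
    and lsc: "lsc_on UNIV \<Phi>" and proper: "\<And>x. \<Phi> x \<noteq> -\<infinity>"
    and bound: "\<And>n. \<Phi> (p n) \<le> ereal C" and K: "0 < K"
    and le: "\<And>n x. norm (x - y n) \<le> 1 \<Longrightarrow>
      \<Phi> (p n) \<le> \<Phi> x + ereal (g n \<bullet> (x - p n) + K * (norm (x - y n))\<^sup>2)"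
    and lim: "p \<longlonglongrightarrow> l" "y \<longlonglongrightarrow> l" "g \<longlonglongrightarrow> grad H l"
  shows "(\<lambda>n. ereal (H (p n)) + \<Phi> (p n)) \<longlonglongrightarrow> ereal (H l) + \<Phi> l \<and> l \<in> crit (\<lambda>x. ereal (H x) + \<Phi> x)"
proof -
  have Hlim: "(\<lambda>n. ereal (H (X n))) \<longlonglongrightarrow> ereal (H l)" if "X \<longlonglongrightarrow> l" for X :: "nat \<Rightarrow> 'a"
  proof -
    have "isCont H l" using H[of l] unfolding gderiv_def by (rule has_derivative_continuous)
    with that show ?thesis by (simp add: isCont_tendsto_compose)
  qed
  have "\<Phi> l \<le> liminf (\<lambda>n. \<Phi> (p n))"
    using lim by (intro lsc_on_liminf[OF lsc]) auto
  also have "\<dots> \<le> liminf (\<lambda>n. ereal C)"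
    using bound by (intro Liminf_mono) auto
  finally have "\<Phi> l \<le> ereal C" by (simp add: Liminf_const)
  then obtain v where v: "\<Phi> l = ereal v" using proper[of l] by (cases "\<Phi> l") auto
  have sum_lim: "(\<lambda>n. ereal (H (X n)) + \<Phi> (X n)) \<longlonglongrightarrow> ereal (H l) + \<Phi> l"
    if "X \<longlonglongrightarrow> l" "(\<lambda>n. \<Phi> (X n)) \<longlonglongrightarrow> \<Phi> l" for X :: "nat \<Rightarrow> 'a"
    using that Hlim[OF that(1)] v by (intro tendsto_add_ereal) auto
  have py: "(\<lambda>n. norm (p n - y n)) \<longlonglongrightarrow> 0"
    using tendsto_norm[OF tendsto_diff[OF lim(1,2)]] by simp
  have ly: "(\<lambda>n. norm (l - y n)) \<longlonglongrightarrow> 0"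
    using tendsto_norm[OF tendsto_diff[OF tendsto_const[of l] lim(2)]] by simp
  have \<Phi>p: "(\<lambda>n. \<Phi> (p n)) \<longlonglongrightarrow> \<Phi> l"
  proof (rule lsc_on_tendsto[OF lsc lim(1)])
    have "\<forall>\<^sub>F n in sequentially. norm (l - y n) < 1"
      using ly by (rule order_tendstoD) simp
    then show "\<forall>\<^sub>F n in sequentially. \<Phi> (p n) \<le> ereal (v + (g n \<bullet> (l - p n) + K * (norm (l - y n))\<^sup>2))"
      by eventually_elim (use le[of l] v in force)
    have "(\<lambda>n. v + (g n \<bullet> (l - p n) + K * (norm (l - y n))\<^sup>2)) \<longlonglongrightarrow> v + (grad H l \<bullet> (l - l) + K * 0\<^sup>2)"
      by (intro tendsto_intros lim ly)
    then show "(\<lambda>n. ereal (v + (g n \<bullet> (l - p n) + K * (norm (l - y n))\<^sup>2))) \<longlonglongrightarrow> \<Phi> l"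
      using v by simp
  qed
  have "\<forall>\<^sub>F n in sequentially. norm (p n - y n) < 1 / 2"
    using py by (rule order_tendstoD) simp
  \<comment> \<open>Shifting by \<open>m\<close> makes the closeness of \<open>p\<close> and
    \<open>y\<close> hold at every index, so that a full sequence \<open>q\<close> can be
    chosen.\<close>
  then obtain m where "\<forall>n\<ge>m. norm (p n - y n) < 1 / 2"
    unfolding eventually_sequentially by blast
  then have m: "norm (p (n + m) - y (n + m)) < 1 / 2" for n
    by (metis le_add2)
  have fin: "\<Phi> (p n) < \<infinity>" for n using bound[of n] by (cases "\<Phi> (p n)") auto
  define near where "near n q \<longleftrightarrow> norm (q - y (n + m)) \<le> 2 * norm (p (n + m) - y (n + m)) \<and>
    \<Phi> q \<le> \<Phi> (p (n + m)) + ereal (g (n + m) \<bullet> (p (n + m) - q) + 2 * K * (norm (p (n + m) - y (n + m)))\<^sup>2) \<and>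
    grad H q - g (n + m) - (4 * K) *\<^sub>R (q - y (n + m)) \<in> frechet_subdiff (\<lambda>x. ereal (H x) + \<Phi> x) q" for n q
  have "\<exists>q. near n q" for n
    unfolding near_def
    by (rule frechet_subdiff_near_minimiser[OF H lsc proper fin m[of n] K le]) (assumption, blast)
  then obtain q where near: "\<And>n. near n (q n)" by metis
  have q1: "norm (q n - y (n + m)) \<le> 2 * norm (p (n + m) - y (n + m))"
    and q2: "\<Phi> (q n) \<le> \<Phi> (p (n + m)) +
          ereal (g (n + m) \<bullet> (p (n + m) - q n) + 2 * K * (norm (p (n + m) - y (n + m)))\<^sup>2)"
    and q3: "grad H (q n) - g (n + m) - (4 * K) *\<^sub>R (q n - y (n + m))
                 \<in> frechet_subdiff (\<lambda>x. ereal (H x) + \<Phi> x) (q n)" for n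
    using near[of n] unfolding near_def by simp_all
  have lim': "(\<lambda>n. p (n + m)) \<longlonglongrightarrow> l" "(\<lambda>n. y (n + m)) \<longlonglongrightarrow> l" "(\<lambda>n. g (n + m)) \<longlonglongrightarrow> grad H l"
    using lim by (simp_all add: LIMSEQ_ignore_initial_segment)
  have py': "(\<lambda>n. norm (p (n + m) - y (n + m))) \<longlonglongrightarrow> 0"
    using py by (rule LIMSEQ_ignore_initial_segment)
  have "(\<lambda>n. 2 * norm (p (n + m) - y (n + m))) \<longlonglongrightarrow> 0"
    using tendsto_mult[OF tendsto_const[of 2] py'] by simp
  then have "(\<lambda>n. q n - y (n + m)) \<longlonglongrightarrow> 0"
    by (rule Lim_null_comparison[rotated]) (use q1 in simp)
  from tendsto_add[OF this lim'(2)] have q: "q \<longlonglongrightarrow> l" by simp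
  have "(\<lambda>n. \<Phi> (q n)) \<longlonglongrightarrow> \<Phi> l"
  proof (rule lsc_on_tendsto[OF lsc q])
    have "(\<lambda>n. g (n + m) \<bullet> (p (n + m) - q n) + 2 * K * (norm (p (n + m) - y (n + m)))\<^sup>2) \<longlonglongrightarrow>
      grad H l \<bullet> (l - l) + 2 * K * 0\<^sup>2"
      by (intro tendsto_intros lim' q py')
    then have "(\<lambda>n. ereal (g (n + m) \<bullet> (p (n + m) - q n) + 2 * K * (norm (p (n + m) - y (n + m)))\<^sup>2)) \<longlonglongrightarrow> 0"
      by (simp add: zero_ereal_def)
    from tendsto_add_ereal[OF _ _ LIMSEQ_ignore_initial_segment[OF \<Phi>p, of m] this]
    show "(\<lambda>n. \<Phi> (p (n + m)) + ereal (g (n + m) \<bullet> (p (n + m) - q n) + 2 * K * (norm (p (n + m) - y (n + m)))\<^sup>2)) \<longlonglongrightarrow> \<Phi> l"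
      using v by simp
  qed (use q2 in simp)
  from sum_lim[OF q this] have Jq: "(\<lambda>n. ereal (H (q n)) + \<Phi> (q n)) \<longlonglongrightarrow> ereal (H l) + \<Phi> l" .
  have "(\<lambda>n. grad H (q n)) \<longlonglongrightarrow> grad H l"
    using H' q by (simp add: continuous_on_eq_continuous_at isCont_tendsto_compose)
  then have "(\<lambda>n. grad H (q n) - g (n + m) - (4 * K) *\<^sub>R (q n - y (n + m))) \<longlonglongrightarrow>
    grad H l - grad H l - (4 * K) *\<^sub>R (l - l)"
    by (intro tendsto_intros lim' q)
  then have "(\<lambda>n. grad H (q n) - g (n + m) - (4 * K) *\<^sub>R (q n - y (n + m))) \<longlonglongrightarrow> 0"
    by simp
  with q Jq q3 have "0 \<in> limiting_subdiff (\<lambda>x. ereal (H x) + \<Phi> x) l"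
    unfolding limiting_subdiff_def
    by (intro CollectI exI[of _ q] exI[of _ "\<lambda>n. grad H (q n) - g (n + m) - (4 * K) *\<^sub>R (q n - y (n + m))"]) simp
  then show ?thesis
    using sum_lim[OF lim(1) \<Phi>p] unfolding crit_def by blast
qed

subsection \<open>Blocks\<close>

lemma subspace_bspace: "subspace (bspace blk i)"
  by (auto simp: subspace_def bspace_def)

lemma block_in_bspace: "block blk i x \<in> bspace blk i"
  by (simp add: block_def bspace_def)

lemma linear_block: "linear (block blk i)"
  by (rule linearI) (auto simp: block_def vec_eq_iff)

lemma block_diff: "block blk i (x - y) = block blk i x - block blk i y"
  using linear_block by (rule linear_diff)

lemma inner_block_left: "block blk i x \<bullet> block blk i y = block blk i x \<bullet> y"
  by (auto simp: block_def inner_vec_def intro!: sum.cong)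

lemma inner_block_commute: "block blk i x \<bullet> y = x \<bullet> block blk i y"
  by (auto simp: block_def inner_vec_def intro!: sum.cong)

lemma norm_block_le: "norm (block blk i x) \<le> norm x"
  unfolding norm_vec_def by (intro L2_set_mono) (auto simp: block_def)

lemma sum_block:
  assumes "range blk = {1..N}"
  shows "(\<Sum>i=1..N. block blk i x) = x"
proof -
  have "blk j \<in> {1..N}" for j using assms by blast
  then show ?thesis by (simp add: vec_eq_iff block_def)
qed

lemma sum_norm_block:
  assumes "range blk = {1..N}"
  shows "(\<Sum>i=1..N. (norm (block blk i x))\<^sup>2) = (norm x)\<^sup>2"
proof -
  have "(\<Sum>i=1..N. (norm (block blk i x))\<^sup>2) = (\<Sum>i=1..N. block blk i x) \<bullet> x"
    by (simp add: power2_norm_eq_inner inner_block_left inner_sum_left)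
  then show ?thesis unfolding sum_block[OF assms] by (simp only: power2_norm_eq_inner)
qed

lemma splice_eq_add_block: "splice blk i a c b = splice blk i a 0 b + block blk i c"
  by (simp add: splice_def block_def vec_eq_iff)

lemma splice_block: "splice blk i a (block blk i c) b = splice blk i a c b"
  by (simp add: splice_def block_def vec_eq_iff)

text \<open>This makes a sweep telescope: the state left by one update is the state met by the next,
  and the two lemmas below give the end points.\<close>

lemma splice_Suc: "splice blk i x' x' x = splice blk (Suc i) x' x x"
  by (auto simp: splice_def vec_eq_iff less_Suc_eq)

lemma splice_first: "range blk = {1..N} \<Longrightarrow> splice blk 1 x' x x = x"
  by (force simp: splice_def vec_eq_iff set_eq_iff image_iff)

lemma splice_last:
  assumes "range blk = {1..N}"
  shows "splice blk (Suc N) x' x x = x'"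
proof -
  have "blk j \<le> N" for j using assms by (metis atLeastAtMost_iff rangeI)
  then show ?thesis by (simp add: splice_def vec_eq_iff less_Suc_eq_le)
qed

lemma tendsto_splice:
  assumes "(a \<longlongrightarrow> l) G" "(c \<longlongrightarrow> l) G" "(b \<longlongrightarrow> l) G"
  shows "((\<lambda>n. splice blk i (a n) (c n) (b n)) \<longlongrightarrow> l) G"
proof (rule vec_tendstoI)
  fix j
  show "((\<lambda>n. splice blk i (a n) (c n) (b n) $ j) \<longlongrightarrow> l $ j) G"
    by (cases "blk j < i"; cases "blk j = i") (simp_all add: splice_def tendsto_vec_nth assms)
qed

text \<open>By \<open>splice_eq_add_block\<close> the inner map is affine with the block projection
  as linear part; being self-adjoint, the projection moves onto the gradient in the chain
  rule.\<close>

lemma GDERIV_splice: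
  assumes H: "\<And>x. GDERIV H x :> grad H x"
  shows "GDERIV (\<lambda>c. H (splice blk i a c b)) u :> block blk i (grad H (splice blk i a u b))"
proof -
  have "(block blk i has_derivative block blk i) (at u)"
    by (simp add: bounded_linear_imp_has_derivative linear_block linear_linear)
  then have "((\<lambda>c. splice blk i a 0 b + block blk i c) has_derivative block blk i) (at u)"
    using has_derivative_add[OF has_derivative_const] by fastforce
  then have s: "((\<lambda>c. splice blk i a c b) has_derivative block blk i) (at u)"
    by (simp flip: splice_eq_add_block)
  have "((\<lambda>c. H (splice blk i a c b)) has_derivative
      (\<lambda>h. block blk i h \<bullet> grad H (splice blk i a u b))) (at u)"
    using has_derivative_compose[OF s H[unfolded gderiv_def]] .
  then show ?thesis
    by (simp only: gderiv_def inner_block_commute)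
qed

subsection \<open>Descent and approximate minimality of a pass\<close>

text \<open>Minimality of \<open>x'\<close> tested against \<open>v\<close>, with the operator
  removed by \<open>ip_inv_into\<close>. Both descent and approximate minimality of a pass rest on
  this inequality.\<close>

lemma block_update_prox_le:
  assumes u: "block_update E D h f c y x'" and E: "subspace E" and y: "y \<in> E" and v: "v \<in> E"
    and g: "\<And>w. w \<in> E \<Longrightarrow> grad h w \<in> E"
  shows "x' \<in> E"
    and "f x' \<le> f v + ereal (grad h y \<bullet> (v - x')
           + 1 / (2 * ch_sigma c) * (ch_d c v y)\<^sup>2 - 1 / (2 * ch_sigma c) * (ch_d c x' y)\<^sup>2)"
proof -
  have spd: "spd_on E (ch_R c)"
    using u unfolding block_update_def by blast
  have arg: "is_arg_min
       (\<lambda>x. f x + ereal (1 / (2 * ch_sigma c) * (ch_d c x y)\<^sup>2 + grad h y \<bullet> (x - y))) (\<lambda>x. x \<in> E) x'"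
    using u unfolding block_update_def ip_inv_into[OF spd E g[OF y]] by blast
  then show "x' \<in> E" unfolding is_arg_min_def by blast
  have "f x' + ereal (1 / (2 * ch_sigma c) * (ch_d c x' y)\<^sup>2 + grad h y \<bullet> (x' - y))
    \<le> f v + ereal (1 / (2 * ch_sigma c) * (ch_d c v y)\<^sup>2 + grad h y \<bullet> (v - y))"
    using arg v unfolding is_arg_min_def by (meson not_le_imp_less)
  then show "f x' \<le> f v + ereal (grad h y \<bullet> (v - x')
           + 1 / (2 * ch_sigma c) * (ch_d c v y)\<^sup>2 - 1 / (2 * ch_sigma c) * (ch_d c x' y)\<^sup>2)"
    by (cases "f x'"; cases "f v") (auto simp: inner_diff_right)
qed

text \<open>Without extrapolation the competitor \<open>x\<close> is at distance \<open>0\<close>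
  from the centre. The proximal gain \<open>ch_gamma c * ch_s c / 2\<close> exceeds the smoothness
  loss \<open>ch_L c / 2\<close>, which is below \<open>ch_s c / 2\<close>; both are multiplied by
  the squared metric.\<close>

lemma block_update_descent:
  assumes u: "block_update E D h f c x x'" and E: "subspace E" and x: "x \<in> E"
    and g: "\<And>w. w \<in> E \<Longrightarrow> grad h w \<in> E" and D: "\<And>d. d \<in> D \<Longrightarrow> Metric_space E d"
  shows "f x' \<le> f x + ereal (h x - h x' - (ch_gamma c - 1) * ch_s c / 2 * (ch_d c x' x)\<^sup>2)"
proof -
  note prox = block_update_prox_le[OF u E x x g]
  have spd: "spd_on E (ch_R c)" and d: "ch_d c \<in> D" and pos: "0 < ch_L c" "ch_L c < ch_s c" "1 < ch_gamma c"
    using u unfolding block_update_def by blast+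
  have d0: "ch_d c x x = 0"
    using D[OF d] x by (simp add: Metric_space.mdist_zero)
  have "h x' \<le> h x + ip (ch_R c) (inv_into E (ch_R c) (grad h x)) (x' - x) + ch_L c / 2 * (ch_d c x' x)\<^sup>2"
    using u x prox(1) unfolding block_update_def by blast
  then have h: "h x' \<le> h x + grad h x \<bullet> (x' - x) + ch_L c / 2 * (ch_d c x' x)\<^sup>2"
    by (simp add: ip_inv_into[OF spd E g[OF x]])
  have "ch_L c / 2 * (ch_d c x' x)\<^sup>2 \<le> ch_s c / 2 * (ch_d c x' x)\<^sup>2"
    using pos by (intro mult_right_mono) auto
  then have "grad h x \<bullet> (x - x') + 1 / (2 * ch_sigma c) * (ch_d c x x)\<^sup>2 - 1 / (2 * ch_sigma c) * (ch_d c x' x)\<^sup>2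
    \<le> h x - h x' - (ch_gamma c - 1) * ch_s c / 2 * (ch_d c x' x)\<^sup>2"
    using h by (simp add: d0 ch_sigma_def inner_diff_right left_diff_distrib diff_divide_distrib)
  then show ?thesis
    using prox(2) by (meson add_left_mono ereal_less_eq(3) order_trans)
qed

lemma sum_ereal_le_add:
  fixes f g :: "'b \<Rightarrow> ereal"
  assumes "\<And>i. i \<in> I \<Longrightarrow> f i \<le> g i + ereal (r i)"
  shows "sum f I \<le> sum g I + ereal (sum r I)"
proof -
  have "sum f I \<le> (\<Sum>i\<in>I. g i + ereal (r i))" using assms by (rule sum_mono)
  then show ?thesis by (simp add: sum.distrib)
qed

lemma grad_splice_in_bspace:
  assumes "\<And>x. GDERIV H x :> grad H x"
  shows "grad (\<lambda>v. H (splice blk i a v b)) w = block blk i (grad H (splice blk i a w b))"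
    and "grad (\<lambda>v. H (splice blk i a v b)) w \<in> bspace blk i"
  by (simp_all add: grad_eqI[OF GDERIV_splice[OF assms]] block_in_bspace)

text \<open>A sweep with parameter \<open>0\<close> decreases the objective by itself, which makes
  the second pass of the algorithm safe. The block estimates add up because the values of
  \<open>H\<close> telescope and the squared block norms sum to the squared norm.\<close>

lemma pass_descent:
  assumes blocks: "range blk = {1..N}" and H: "\<And>x. GDERIV H x :> grad H x"
    and D: "\<And>i d. i \<in> {1..N} \<Longrightarrow> d \<in> D i \<Longrightarrow> Metric_space (bspace blk i) d"
    and pass: "pass N blk H F D 0 xp x c x'"
    and a: "0 \<le> a" "\<And>i. i \<in> {1..N} \<Longrightarrow> a \<le> (ch_gamma (c i) - 1) * ch_s (c i)"
    and b: "0 \<le> b" "\<And>i. i \<in> {1..N} \<Longrightarrow> b * norm (block blk i x' - block blk i x) \<le> ch_d (c i) (block blk i x') (block blk i x)"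
  shows "objective N blk H F x' \<le> objective N blk H F x - ereal (a / 2 * b\<^sup>2 * (norm (x' - x))\<^sup>2)"
proof -
  \<comment> \<open>The smooth part just before block \<open>i\<close> is updated.\<close>
  define h where "h i = H (splice blk i x' x x)" for i
  have "F i (block blk i x') \<le> F i (block blk i x) +
      ereal (h i - h (Suc i) - a / 2 * b\<^sup>2 * (norm (block blk i (x' - x)))\<^sup>2)" if i: "i \<in> {1..N}" for i
  proof -
    let ?h = "\<lambda>v. H (splice blk i x' v x)" and ?d = "ch_d (c i) (block blk i x') (block blk i x)"
    have "block_update (bspace blk i) (D i) ?h (F i) (c i) (block blk i x) (block blk i x')"
      using pass i unfolding pass_def by force
    from block_update_descent[OF this subspace_bspace block_in_bspace grad_splice_in_bspace(2)[OF H] D[OF i]]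
    have "F i (block blk i x') \<le> F i (block blk i x) +
        ereal (h i - h (Suc i) - (ch_gamma (c i) - 1) * ch_s (c i) / 2 * ?d\<^sup>2)"
      by (simp add: splice_block h_def splice_Suc)
    moreover have "a / 2 * b\<^sup>2 * (norm (block blk i (x' - x)))\<^sup>2 \<le> (ch_gamma (c i) - 1) * ch_s (c i) / 2 * ?d\<^sup>2"
    proof -
      have "b\<^sup>2 * (norm (block blk i (x' - x)))\<^sup>2 \<le> ?d\<^sup>2"
        unfolding power_mult_distrib[symmetric] block_diff using b i by (intro power_mono) auto
      then show ?thesis
        using a(1) a(2)[OF i] unfolding mult.assoc by (intro mult_mono) auto
    qed
    ultimately show ?thesis
      by (elim order_trans) (intro add_left_mono, simp)
  qed
  then have "(\<Sum>i=1..N. F i (block blk i x')) \<le> (\<Sum>i=1..N. F i (block blk i x)) +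
      ereal (\<Sum>i=1..N. h i - h (Suc i) - a / 2 * b\<^sup>2 * (norm (block blk i (x' - x)))\<^sup>2)"
    by (rule sum_ereal_le_add)
  also have "(\<Sum>i=1..N. h i - h (Suc i) - a / 2 * b\<^sup>2 * (norm (block blk i (x' - x)))\<^sup>2)
    = - (\<Sum>i=1..N. h (Suc i) - h i) - a / 2 * b\<^sup>2 * (\<Sum>i=1..N. (norm (block blk i (x' - x)))\<^sup>2)"
    by (simp add: sum_subtractf sum_distrib_left)
  also have "\<dots> = H x - H x' - a / 2 * b\<^sup>2 * (norm (x' - x))\<^sup>2"
    unfolding sum_norm_block[OF blocks] by (subst sum_Suc_diff) (simp_all add: h_def splice_first[OF blocks, simplified] splice_last[OF blocks])
  finally show ?thesis
    unfolding objective_def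
    by (cases "\<Sum>i=1..N. F i (block blk i x')"; cases "\<Sum>i=1..N. F i (block blk i x)") auto
qed

text \<open>Brings a passed descent test into the form of \<open>pass_descent\<close>, since on each
  block the metric dominates \<open>b\<close> times the norm.\<close>

lemma sufficient_descent:
  assumes blocks: "range blk = {1..N}"
    and suff: "\<not> insufficient_descent N blk H F \<rho> x c x'" and "0 \<le> \<rho>"
    and b: "0 \<le> b" "\<And>i. i \<in> {1..N} \<Longrightarrow> b * norm (block blk i x' - block blk i x) \<le> ch_d (c i) (block blk i x') (block blk i x)"
  shows "objective N blk H F x' \<le> objective N blk H F x - ereal (\<rho> * b\<^sup>2 * (norm (x' - x))\<^sup>2)"
proof -
  have "b\<^sup>2 * (norm (x' - x))\<^sup>2 = (\<Sum>i=1..N. (b * norm (block blk i x' - block blk i x))\<^sup>2)"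
    unfolding sum_norm_block[OF blocks, of "x' - x", symmetric] by (simp add: sum_distrib_left power_mult_distrib block_diff)
  also have "\<dots> \<le> (\<Sum>i=1..N. (ch_d (c i) (block blk i x') (block blk i x))\<^sup>2)"
    using b by (intro sum_mono power_mono) auto
  finally have "\<rho> * b\<^sup>2 * (norm (x' - x))\<^sup>2 \<le> \<rho> * (\<Sum>i=1..N. (ch_d (c i) (block blk i x') (block blk i x))\<^sup>2)"
    using \<open>0 \<le> \<rho>\<close> by (simp add: mult.assoc mult_left_mono)
  then have "objective N blk H F x - ereal (\<rho> * (\<Sum>i=1..N. (ch_d (c i) (block blk i x') (block blk i x))\<^sup>2))
    \<le> objective N blk H F x - ereal (\<rho> * b\<^sup>2 * (norm (x' - x))\<^sup>2)"
    by (intro ereal_minus_mono) simp_all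
  then show ?thesis
    using suff unfolding insufficient_descent_def by simp
qed

text \<open>The Gauss-Seidel substitute for the full gradient: each block is taken at its own
  intermediate point, with the extrapolated \<open>y\<close> in block \<open>i\<close> itself. These
  points share a limit once \<open>x'\<close>, \<open>y\<close> and \<open>x\<close> do.\<close>

definition sweep_gradient ::
  "nat \<Rightarrow> ('n::finite \<Rightarrow> nat) \<Rightarrow> (real^'n \<Rightarrow> real) \<Rightarrow> real^'n \<Rightarrow> real^'n \<Rightarrow> real^'n \<Rightarrow> real^'n" where
  "sweep_gradient N blk H x' y x = (\<Sum>i=1..N. block blk i (grad H (splice blk i x' y x)))"

lemma tendsto_sweep_gradient:
  assumes blocks: "range blk = {1..N}" and H: "continuous_on UNIV (grad H)"
    and lim: "x' \<longlonglongrightarrow> l" "y \<longlonglongrightarrow> l" "x \<longlonglongrightarrow> l"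
  shows "(\<lambda>n. sweep_gradient N blk H (x' n) (y n) (x n)) \<longlonglongrightarrow> grad H l"
proof -
  have "isCont (grad H) l" using H by (simp add: continuous_on_eq_continuous_at)
  then have "(\<lambda>n. sweep_gradient N blk H (x' n) (y n) (x n)) \<longlonglongrightarrow> (\<Sum>i=1..N. block blk i (grad H l))"
    unfolding sweep_gradient_def
    by (intro tendsto_sum bounded_linear.tendsto[OF linear_conv_bounded_linear[THEN iffD1, OF linear_block]]
        isCont_tendsto_compose[of l "grad H"] tendsto_splice lim)
  then show ?thesis unfolding sum_block[OF blocks] .
qed

text \<open>All blocks are compared with those of one common competitor \<open>v\<close>. The
  squared metric at \<open>x'\<close> enters with a favourable sign and is dropped, the one at
  \<open>v\<close> is at most \<open>M\<^sup>2\<close> times the squared norm, and summation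
  restores the full inner product and norm.\<close>

lemma pass_approx_minimiser:
  assumes blocks: "range blk = {1..N}" and H: "\<And>x. GDERIV H x :> grad H x"
    and pass: "pass N blk H F D \<beta> xp x c x'" and y: "y = x + \<beta> *\<^sub>R (x - xp)"
    and \<sigma>: "0 < \<sigma>" "\<And>i. i \<in> {1..N} \<Longrightarrow> \<sigma> \<le> ch_sigma (c i)"
    and D: "\<And>i d. i \<in> {1..N} \<Longrightarrow> d \<in> D i \<Longrightarrow> Metric_space (bspace blk i) d"
    and M: "\<And>i d u w. i \<in> {1..N} \<Longrightarrow> d \<in> D i \<Longrightarrow> u \<in> bspace blk i \<Longrightarrow> w \<in> bspace blk i \<Longrightarrow>
          norm w \<le> r \<Longrightarrow> norm (u - w) \<le> 1 \<Longrightarrow> d u w \<le> M * norm (u - w)"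
    and r: "norm y \<le> r" and v: "norm (v - y) \<le> 1"
  shows "(\<Sum>i=1..N. F i (block blk i x')) \<le> (\<Sum>i=1..N. F i (block blk i v)) +
    ereal (sweep_gradient N blk H x' y x \<bullet> (v - x') + M\<^sup>2 / (2 * \<sigma>) * (norm (v - y))\<^sup>2)"
proof -
  let ?g = "\<lambda>i. block blk i (grad H (splice blk i x' y x))"
  have "F i (block blk i x') \<le> F i (block blk i v) +
      ereal (?g i \<bullet> (v - x') + M\<^sup>2 / (2 * \<sigma>) * (norm (block blk i (v - y)))\<^sup>2)" if i: "i \<in> {1..N}" for i
  proof -
    let ?h = "\<lambda>v. H (splice blk i x' v x)" and ?d = "ch_d (c i)"
    let ?A = "1 / (2 * ch_sigma (c i)) * (?d (block blk i v) (block blk i y))\<^sup>2"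
    let ?B = "1 / (2 * ch_sigma (c i)) * (?d (block blk i x') (block blk i y))\<^sup>2"
    have u: "block_update (bspace blk i) (D i) ?h (F i) (c i) (block blk i y) (block blk i x')"
      using pass i unfolding pass_def y by blast
    then have d: "?d \<in> D i" unfolding block_update_def by blast
    have "F i (block blk i x') \<le> F i (block blk i v) +
        ereal (?g i \<bullet> (v - x') + ?A - ?B)"
      using block_update_prox_le(2)[OF u subspace_bspace block_in_bspace block_in_bspace grad_splice_in_bspace(2)[OF H]]
      by (simp add: grad_splice_in_bspace(1)[OF H] splice_block inner_block_left flip: block_diff)
    moreover have "0 \<le> ?B" using \<sigma>(1) \<sigma>(2)[OF i] by simp
    moreover have "?A \<le> M\<^sup>2 / (2 * \<sigma>) * (norm (block blk i (v - y)))\<^sup>2"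
    proof -
      have "?d (block blk i v) (block blk i y) \<le> M * norm (block blk i v - block blk i y)"
      proof (rule M[OF i d block_in_bspace block_in_bspace])
        show "norm (block blk i y) \<le> r" using norm_block_le[of blk i y] r by simp
        show "norm (block blk i v - block blk i y) \<le> 1"
          using norm_block_le[of blk i "v - y"] v by (simp add: block_diff)
      qed
      then have "(?d (block blk i v) (block blk i y))\<^sup>2 \<le> (M * norm (block blk i v - block blk i y))\<^sup>2"
        by (rule power_mono) (simp add: Metric_space.nonneg[OF D[OF i d]])
      moreover have "1 / (2 * ch_sigma (c i)) \<le> 1 / (2 * \<sigma>)"
        using \<sigma>(1) \<sigma>(2)[OF i] by (intro divide_left_mono) auto
      ultimately have "?A \<le> 1 / (2 * \<sigma>) * (M * norm (block blk i v - block blk i y))\<^sup>2"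
        using \<sigma>(1) by (intro mult_mono) auto
      then show ?thesis by (simp add: power_mult_distrib block_diff)
    qed
    ultimately show ?thesis
      by (elim order_trans) (intro add_left_mono, simp)
  qed
  then have "(\<Sum>i=1..N. F i (block blk i x')) \<le> (\<Sum>i=1..N. F i (block blk i v)) +
      ereal (\<Sum>i=1..N. ?g i \<bullet> (v - x') + M\<^sup>2 / (2 * \<sigma>) * (norm (block blk i (v - y)))\<^sup>2)"
    by (rule sum_ereal_le_add)
  also have "(\<Sum>i=1..N. ?g i \<bullet> (v - x') + M\<^sup>2 / (2 * \<sigma>) * (norm (block blk i (v - y)))\<^sup>2) =
      sweep_gradient N blk H x' y x \<bullet> (v - x') + M\<^sup>2 / (2 * \<sigma>) * (norm (v - y))\<^sup>2"
    unfolding sum.distrib sweep_gradient_def inner_sum_left sum_distrib_left[symmetric] sum_norm_block[OF blocks] ..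
  finally show ?thesis .
qed

lemma t_seq_ge_1: "1 \<le> t_seq k"
proof (induction k rule: t_seq.induct)
  case (3 k)
  have "1 \<le> sqrt (1 + 4 * (t_seq (Suc k))\<^sup>2)" by simp
  then show ?case by simp
qed simp_all

text \<open>From \<open>sqrt ((2 * t)\<^sup>2) \<le> sqrt (1 + 4 * t\<^sup>2)\<close> it follows
  that \<open>t_seq\<close> does not decrease. The bound \<open>1\<close> keeps an extrapolated
  point within one previous step length of the iterate.\<close>

lemma beta_seq_bounds: "0 \<le> beta_seq k \<and> beta_seq k \<le> 1"
proof (cases "k \<le> 1")
  case False
  then obtain j where k: "k = Suc (Suc j)"
    by (intro that[of "k - 2"]) simp
  have "2 * t_seq (Suc j) = sqrt ((2 * t_seq (Suc j))\<^sup>2)"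
    using t_seq_ge_1[of "Suc j"] unfolding real_sqrt_abs by linarith
  also have "\<dots> \<le> sqrt (1 + 4 * (t_seq (Suc j))\<^sup>2)"
    by (intro real_sqrt_le_mono) (simp add: power2_eq_square)
  finally have "t_seq (Suc j) \<le> t_seq k" by (simp add: k)
  then show ?thesis
    using t_seq_ge_1[of "Suc j"] t_seq_ge_1[of k] 
    by (simp add: beta_seq_def k del: t_seq.simps)
qed (simp add: beta_seq_def)

subsection \<open>Convergence\<close>

text \<open>The values stay finite by induction, decrease and are bounded below, so they converge;
  their successive differences tend to \<open>0\<close> and dominate \<open>b\<close> times the
  squared step lengths.\<close>

lemma sufficient_decrease:
  fixes J :: "'a::real_normed_vector \<Rightarrow> ereal"
  assumes dec: "\<And>k. J (x (Suc k)) \<le> J (x k) - ereal (b * (norm (x (Suc k) - x k))\<^sup>2)"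
    and b: "0 < b" and fin: "J (x 0) < \<infinity>" and bound: "\<And>k. ereal m \<le> J (x k)"
  shows "J (x k) \<le> J (x 0)"
    and "\<exists>v. (\<lambda>k. J (x k)) \<longlonglongrightarrow> ereal v"
    and "(\<lambda>k. x (Suc k) - x k) \<longlonglongrightarrow> 0"
proof -
  have "\<exists>a. J (x k) = ereal a" for k
  proof (induction k)
    case 0
    show ?case using fin bound[of 0] by (cases "J (x 0)") auto
  next
    case (Suc k)
    then show ?case using dec[of k] bound[of "Suc k"] by (cases "J (x (Suc k))") auto
  qed
  then obtain a where a: "\<And>k. J (x k) = ereal (a k)" by metis
  have dec': "b * (norm (x (Suc k) - x k))\<^sup>2 \<le> a k - a (Suc k)" for k
    using dec[of k] by (simp add: a)
  have "a (Suc k) \<le> a k" for k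
    using dec'[of k] b by (smt (verit) mult_nonneg_nonneg zero_le_power2)
  then have "decseq a" by (simp add: decseq_Suc_iff)
  then show "J (x k) \<le> J (x 0)" by (simp add: a decseqD)
  have "\<forall>k. m \<le> a k" using bound by (simp add: a)
  then obtain v where v: "a \<longlonglongrightarrow> v"
    using decseq_convergent[OF \<open>decseq a\<close>] by metis
  then show "\<exists>v. (\<lambda>k. J (x k)) \<longlonglongrightarrow> ereal v" by (auto simp: a)
  have "(\<lambda>k. (a k - a (Suc k)) / b) \<longlonglongrightarrow> (v - v) / b"
    using b by (intro tendsto_intros v LIMSEQ_Suc) auto
  then have "(\<lambda>k. (a k - a (Suc k)) / b) \<longlonglongrightarrow> 0" by simp
  then have "(\<lambda>k. (norm (x (Suc k) - x k))\<^sup>2) \<longlonglongrightarrow> 0"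
    by (rule Lim_null_comparison[rotated]) (use dec' b in \<open>simp add: field_simps\<close>)
  then have "(\<lambda>k. norm (x (Suc k) - x k)) \<longlonglongrightarrow> 0"
    by (simp add: power_tendsto_0_iff)
  then show "(\<lambda>k. x (Suc k) - x k) \<longlonglongrightarrow> 0" by (rule tendsto_norm_zero_cancel)
qed

text \<open>A real infimum is sure to be a lower bound only for a family bounded below; here
  \<open>0\<close> is such a bound.\<close>

lemma le_INF_pos:
  fixes f :: "'b \<Rightarrow> real"
  assumes "\<And>x. x \<in> S \<Longrightarrow> 0 \<le> f x" "x \<in> S"
  shows "(INF x\<in>S. f x) \<le> f x"
  using assms by (intro cINF_lower bdd_belowI2[of _ 0])

text \<open>Merges the two outcomes of the descent test: either the accepted pass met it, or it used
  no extrapolation. Each alternative has its own descent estimate.\<close>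

lemma iGGBPL_pass:
  assumes "iGGBPL N blk H F D \<rho> c z" "1 \<le> k"
  obtains \<beta> where "0 \<le> \<beta>" "\<beta> \<le> 1" "pass N blk H F D \<beta> (z (k - 1)) (z k) (\<lambda>i. c i k) (z (Suc k))"
    "\<beta> = 0 \<or> \<not> insufficient_descent N blk H F \<rho> (z k) (\<lambda>i. c i k) (z (Suc k))"
  using assms beta_seq_bounds[of k] unfolding iGGBPL_def by (metis Suc_eq_plus1 order_refl zero_le_one)

lemma iGGBPL_choice:
  assumes "iGGBPL N blk H F D \<rho> c z" "1 \<le> k" "i \<in> {1..N}"
  shows "ch_d (c i k) \<in> D i" "0 \<le> (ch_gamma (c i k) - 1) * ch_s (c i k)" "0 \<le> ch_sigma (c i k)"
proof -
  obtain \<beta> where "pass N blk H F D \<beta> (z (k - 1)) (z k) (\<lambda>i. c i k) (z (Suc k))"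
    using iGGBPL_pass[OF assms(1,2)] by metis
  then have "ch_d (c i k) \<in> D i" "0 < ch_L (c i k)" "ch_L (c i k) < ch_s (c i k)" "1 < ch_gamma (c i k)"
    using assms(3) unfolding pass_def block_update_def by blast+
  then show "ch_d (c i k) \<in> D i" "0 \<le> (ch_gamma (c i k) - 1) * ch_s (c i k)" "0 \<le> ch_sigma (c i k)"
    by (simp_all add: ch_sigma_def)
qed

text \<open>\<open>sufficient_descent\<close> covers a passed test and \<open>pass_descent\<close> a
  pass with parameter \<open>0\<close>; what remains is one constant for all blocks, all indices and
  both cases.\<close>

lemma iGGBPL_descent:
  assumes blocks: "range blk = {1..N}" and H: "\<And>x. GDERIV H x :> grad H x"
    and B: "\<forall>i\<in>{1..N}. admissible_metrics (bspace blk i) (D i)"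
    and algorithm: "iGGBPL N blk H F D \<rho> c z"
    and a: "0 < a" "\<And>i k. i \<in> {1..N} \<Longrightarrow> 1 \<le> k \<Longrightarrow> a \<le> (ch_gamma (c i k) - 1) * ch_s (c i k)"
  shows "\<exists>b>0. \<forall>k\<ge>1. objective N blk H F (z (Suc k)) \<le>
    objective N blk H F (z k) - ereal (b * (norm (z (Suc k) - z k))\<^sup>2)"
proof -
  have "\<forall>i\<in>{1..N}. \<exists>e>0. \<forall>d\<in>D i. \<forall>x\<in>bspace blk i. \<forall>y\<in>bspace blk i. e * norm (x - y) \<le> d x y"
    using admissible_metrics_ge_norm[OF subspace_bspace] B by blast
  then obtain e where e: "\<And>i. i \<in> {1..N} \<Longrightarrow> 0 < e i"
    "\<And>i d x y. i \<in> {1..N} \<Longrightarrow> d \<in> D i \<Longrightarrow> x \<in> bspace blk i \<Longrightarrow> y \<in> bspace blk i \<Longrightarrow> e i * norm (x - y) \<le> d x y"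
    by metis
  \<comment> \<open>The domain of \<open>blk\<close> is nonempty, so \<open>N\<close> is at least
    \<open>1\<close> and the minimum over the blocks exists.\<close>
  have ne: "{1..N} \<noteq> {}" using blocks by blast
  define e0 where "e0 = Min (e ` {1..N})"
  have e0: "0 < e0" using ne e(1) unfolding e0_def by (subst Min_gr_iff) auto
  have d: "e0 * norm (block blk i u - block blk i w) \<le> ch_d (c i k) (block blk i u) (block blk i w)"
    if "1 \<le> k" "i \<in> {1..N}" for i k u w
  proof -
    have "e0 \<le> e i" using that unfolding e0_def by simp
    then have "e0 * norm (block blk i u - block blk i w) \<le> e i * norm (block blk i u - block blk i w)"
      by (rule mult_right_mono) simp
    also have "\<dots> \<le> ch_d (c i k) (block blk i u) (block blk i w)"
      using that iGGBPL_choice(1)[OF algorithm] by (intro e(2) block_in_bspace)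
    finally show ?thesis .
  qed
  have \<rho>: "0 < \<rho>" using algorithm unfolding iGGBPL_def by blast
  \<comment> \<open>The rate is \<open>\<rho>\<close> for a passed test and \<open>a / 2\<close> for
    a pass without extrapolation, in both cases times \<open>e0\<^sup>2\<close>.\<close>
  define b where "b = min \<rho> (a / 2) * e0\<^sup>2"
  have b: "0 < b" using \<rho> a e0 unfolding b_def by simp
  have met: "\<And>i d. i \<in> {1..N} \<Longrightarrow> d \<in> D i \<Longrightarrow> Metric_space (bspace blk i) d"
    using B unfolding admissible_metrics_def by blast
  have "objective N blk H F (z (Suc k)) \<le> objective N blk H F (z k) - ereal (b * (norm (z (Suc k) - z k))\<^sup>2)"
    if k: "1 \<le> k" for k
  proof -
    obtain \<beta> where pass: "pass N blk H F D \<beta> (z (k - 1)) (z k) (\<lambda>i. c i k) (z (Suc k))"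
      and \<beta>: "\<beta> = 0 \<or> \<not> insufficient_descent N blk H F \<rho> (z k) (\<lambda>i. c i k) (z (Suc k))"
      using iGGBPL_pass[OF algorithm k] by metis
    have "\<exists>t\<ge>min \<rho> (a / 2). objective N blk H F (z (Suc k)) \<le>
      objective N blk H F (z k) - ereal (t * e0\<^sup>2 * (norm (z (Suc k) - z k))\<^sup>2)"
      using \<beta>
    proof
      assume "\<beta> = 0"
      from pass_descent[OF blocks H met pass[unfolded this] _ a(2) _ d] k a(1) e0 show ?thesis
        by (intro exI[of _ "a / 2"]) simp
    next
      assume "\<not> insufficient_descent N blk H F \<rho> (z k) (\<lambda>i. c i k) (z (Suc k))"
      from sufficient_descent[OF blocks this _ _ d] k \<rho> e0 show ?thesis
        by (intro exI[of _ \<rho>]) simp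
    qed
    then obtain t where t: "min \<rho> (a / 2) \<le> t" and le: "objective N blk H F (z (Suc k)) \<le>
      objective N blk H F (z k) - ereal (t * e0\<^sup>2 * (norm (z (Suc k) - z k))\<^sup>2)" by blast
    have "b * (norm (z (Suc k) - z k))\<^sup>2 \<le> t * e0\<^sup>2 * (norm (z (Suc k) - z k))\<^sup>2"
      unfolding b_def by (intro mult_right_mono t) simp_all
    then have "objective N blk H F (z k) - ereal (t * e0\<^sup>2 * (norm (z (Suc k) - z k))\<^sup>2) \<le>
      objective N blk H F (z k) - ereal (b * (norm (z (Suc k) - z k))\<^sup>2)"
      by (intro ereal_minus_mono) simp_all
    with le show ?thesis by (rule order_trans)
  qed
  with b show ?thesis by blast
qed

theorem theorem3:
  fixes N :: nat
    and blk :: "'n::finite \<Rightarrow> nat"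
    and H :: "real^'n \<Rightarrow> real"
    and F :: "nat \<Rightarrow> real^'n \<Rightarrow> ereal"
    and D :: "nat \<Rightarrow> (real^'n \<Rightarrow> real^'n \<Rightarrow> real) set"
    and \<rho> :: real
    and c :: "nat \<Rightarrow> nat \<Rightarrow> (real^'n) choice"
    and z :: "nat \<Rightarrow> real^'n"
  assumes blocks: "range blk = {1..N}"
    and A1: "smooth_part N blk H"
    and A2: "nonsmooth_part N blk F"
    and A3: "objective_conditions (objective N blk H F)"
    and B: "\<forall>i\<in>{1..N}. admissible_metrics (bspace blk i) (D i)"
    and algorithm: "iGGBPL N blk H F D \<rho> c z"
    and gamma_s: "0 < (INF (i, k)\<in>{1..N} \<times> {1..}. (ch_gamma (c i k) - 1) * ch_s (c i k))"
    and sigma: "0 < (INF (i, k)\<in>{1..N} \<times> {1..}. ch_sigma (c i k))"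
  shows "objective N blk H F constant_on cluster_points z \<and>
         cluster_points z \<subseteq> crit (objective N blk H F)"
proof -

  \<comment> \<open>Splitting of the objective and regularity of its parts\<close>
  define \<Phi> where "\<Phi> x = (\<Sum>i=1..N. F i (block blk i x))" for x
  let ?J = "objective N blk H F"
  have J: "?J = (\<lambda>x. ereal (H x) + \<Phi> x)"
    by (simp add: fun_eq_iff objective_def \<Phi>_def)
  have H: "GDERIV H x :> grad H x" for x
    using A1 unfolding smooth_part_def by (intro GDERIV_grad) blast
  have H': "continuous_on UNIV (grad H)"
    using A1 unfolding smooth_part_def by blast
  have F: "proper_on (bspace blk i) (F i)" "lsc_on (bspace blk i) (F i)" if "i \<in> {1..N}" for i
    using A2 that unfolding nonsmooth_part_def by blast+
  have F_proper: "F i (block blk i x) \<noteq> -\<infinity>" if "i \<in> {1..N}" for i x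
    using F(1)[OF that] block_in_bspace unfolding proper_on_def by blast
  have \<Phi>_proper: "\<Phi> x \<noteq> -\<infinity>" for x
    unfolding \<Phi>_def using F_proper by (rule sum_ereal_not_MInfty)
  have lsc: "lsc_on UNIV \<Phi>"
    unfolding \<Phi>_def
  proof (rule lsc_on_sum)
    fix i assume i: "i \<in> {1..N}"
    show "lsc_on UNIV (\<lambda>x. F i (block blk i x))"
      using F(2)[OF i]
      by (rule lsc_on_compose) (auto intro: linear_continuous_on block_in_bspace simp: linear_conv_bounded_linear[symmetric] linear_block)
  qed (rule F_proper)

  \<comment> \<open>Descent and convergence of the objective values\<close>
  have gs: "(INF (i, k)\<in>{1..N} \<times> {1..}. (ch_gamma (c i k) - 1) * ch_s (c i k)) \<le> (ch_gamma (c i k) - 1) * ch_s (c i k)"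
    and sg: "(INF (i, k)\<in>{1..N} \<times> {1..}. ch_sigma (c i k)) \<le> ch_sigma (c i k)"
    if "i \<in> {1..N}" "1 \<le> k" for i k
    using le_INF_pos[of "{1..N} \<times> {1..}" "\<lambda>(i, k). (ch_gamma (c i k) - 1) * ch_s (c i k)" "(i, k)"]
      le_INF_pos[of "{1..N} \<times> {1..}" "\<lambda>(i, k). ch_sigma (c i k)" "(i, k)"] that iGGBPL_choice[OF algorithm] by auto
  obtain b where b: "0 < b" and descent: "\<And>k. 1 \<le> k \<Longrightarrow>
      ?J (z (Suc k)) \<le> ?J (z k) - ereal (b * (norm (z (Suc k) - z k))\<^sup>2)"
    using iGGBPL_descent[OF blocks H B algorithm gamma_s gs] by blast
  obtain m where m: "\<And>x. ereal m \<le> ?J x"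
    using A3 unfolding objective_conditions_def bounded_below_on_def by blast
  have z0: "z 0 = z 1" and z1: "?J (z 1) < \<infinity>"
    using algorithm unfolding iGGBPL_def edom_def by blast+
  \<comment> \<open>Descent is known from index \<open>1\<close> on, hence the shifted sequence;
    \<open>z 0 = z 1\<close> later covers index \<open>0\<close>.\<close>
  have "?J (z (Suc (Suc k))) \<le> ?J (z (Suc k)) - ereal (b * (norm (z (Suc (Suc k)) - z (Suc k)))\<^sup>2)" for k
    using descent[of "Suc k"] by simp
  note decrease = sufficient_decrease[of ?J "\<lambda>k. z (Suc k)", OF this b _ m, simplified, OF z1[simplified]]
  obtain v where v: "(\<lambda>k. ?J (z (Suc k))) \<longlonglongrightarrow> ereal v" using decrease(2) by blast
  then have v: "(\<lambda>k. ?J (z k)) \<longlonglongrightarrow> ereal v" by (rule LIMSEQ_imp_Suc)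
  have diff: "(\<lambda>k. z (Suc k) - z k) \<longlonglongrightarrow> 0"
    using decrease(3) by (rule LIMSEQ_imp_Suc)

  \<comment> \<open>Boundedness of the iterates\<close>
  obtain C where C: "?J (z 1) = ereal C" using z1 m[of "z 1"] by (cases "?J (z 1)") auto
  have JC: "?J (z k) \<le> ereal C" for k
    using decrease(1)[of "k - 1"] C z0 by (cases k) auto
  have "\<forall>\<^sub>F x in at_infinity. ereal C < ?J x"
    using A3 unfolding objective_conditions_def by (intro order_tendstoD(1)) auto
  then obtain R where R: "\<And>x. R \<le> norm x \<Longrightarrow> ereal C < ?J x"
    unfolding eventually_at_infinity by blast
  have zR: "norm (z k) \<le> R" for k
    using R[of "z k"] JC[of k] by force
  \<comment> \<open>A lower bound of \<open>H\<close> on the ball turns the bound on the objective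
    into one on \<open>\<Phi>\<close>.\<close>
  have "continuous_on (cball 0 R) H"
    using H unfolding gderiv_def by (meson continuous_at_imp_continuous_on has_derivative_continuous)
  then have "bounded (H ` cball 0 R)"
    by (intro compact_imp_bounded compact_continuous_image) auto
  then obtain h where "\<forall>x\<in>cball 0 R. norm (H x) \<le> h" unfolding bounded_iff by blast
  then have h: "- h \<le> H (z k)" for k using zR[of k] by force
  have \<Phi>C: "\<Phi> (z k) \<le> ereal (C + h)" for k
    using JC[of k] h[of k] unfolding J by (cases "\<Phi> (z k)") auto

  \<comment> \<open>One constant of approximate minimality for every pass\<close>
  have "\<forall>i\<in>{1..N}. \<exists>M\<ge>0. \<forall>d\<in>D i. \<forall>x\<in>bspace blk i. \<forall>y\<in>bspace blk i.
      norm y \<le> 3 * R \<longrightarrow> norm (x - y) \<le> 1 \<longrightarrow> d x y \<le> M * norm (x - y)"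
    using admissible_metrics_le_norm[OF subspace_bspace] B by blast
  then obtain M where M: "\<And>i. i \<in> {1..N} \<Longrightarrow> 0 \<le> M i"
    "\<And>i d x y. i \<in> {1..N} \<Longrightarrow> d \<in> D i \<Longrightarrow> x \<in> bspace blk i \<Longrightarrow> y \<in> bspace blk i \<Longrightarrow>
      norm y \<le> 3 * R \<Longrightarrow> norm (x - y) \<le> 1 \<Longrightarrow> d x y \<le> M i * norm (x - y)"
    by metis
  \<comment> \<open>The summand \<open>1\<close> makes the common bound, and with it
    \<open>K\<close>, positive.\<close>
  define M0 where "M0 = 1 + (\<Sum>i=1..N. M i)"
  have "M i \<le> M0" if "i \<in> {1..N}" for i
    using member_le_sum[OF that, of M] M(1) unfolding M0_def by fastforce
  then have M0: "d x y \<le> M0 * norm (x - y)"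
    if "i \<in> {1..N}" "d \<in> D i" "x \<in> bspace blk i" "y \<in> bspace blk i" "norm y \<le> 3 * R" "norm (x - y) \<le> 1" for i d x y
    using M(2)[OF that] that(1) by (meson mult_right_mono norm_ge_zero order_trans)
  have "0 < M0" using sum_nonneg[of "{1..N}" M] M(1) unfolding M0_def by fastforce
  define \<sigma> where "\<sigma> = (INF (i, k)\<in>{1..N} \<times> {1..}. ch_sigma (c i k))"
  define K where "K = M0\<^sup>2 / (2 * \<sigma>)"
  have K: "0 < K" using \<open>0 < M0\<close> sigma unfolding K_def \<sigma>_def by simp
  have met: "\<And>i d. i \<in> {1..N} \<Longrightarrow> d \<in> D i \<Longrightarrow> Metric_space (bspace blk i) d"
    using B unfolding admissible_metrics_def by blast
  have "\<forall>k. \<exists>\<beta>. 1 \<le> k \<longrightarrow> 0 \<le> \<beta> \<and> \<beta> \<le> 1 \<and> pass N blk H F D \<beta> (z (k - 1)) (z k) (\<lambda>i. c i k) (z (Suc k))"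
    using iGGBPL_pass[OF algorithm] by metis
  then obtain \<beta> where \<beta>: "\<And>k. 1 \<le> k \<Longrightarrow> 0 \<le> \<beta> k" "\<And>k. 1 \<le> k \<Longrightarrow> \<beta> k \<le> 1"
    and pass: "\<And>k. 1 \<le> k \<Longrightarrow> pass N blk H F D (\<beta> k) (z (k - 1)) (z k) (\<lambda>i. c i k) (z (Suc k))"
    by metis
  define Y where "Y k = z k + \<beta> k *\<^sub>R (z k - z (k - 1))" for k
  have Yz: "norm (Y k - z k) \<le> norm (z k - z (k - 1))" if "1 \<le> k" for k
    using \<beta>[OF that] by (simp add: Y_def mult_left_le_one_le)
  \<comment> \<open>The origin of \<open>3 * R\<close>: \<open>Y k\<close> differs from
    \<open>z k\<close> by at most the distance of two points of the ball of radius
    \<open>R\<close>.\<close>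
  have YR: "norm (Y k) \<le> 3 * R" if "1 \<le> k" for k
    using Yz[OF that] norm_triangle_ineq[of "Y k - z k" "z k"] norm_triangle_ineq4[of "z k" "z (k - 1)"]
      zR[of k] zR[of "k - 1"] by simp

  \<comment> \<open>Values and criticality at cluster points\<close>
  have "?J l = ereal v \<and> l \<in> crit ?J" if l: "l \<in> cluster_points z" for l
  proof -
    obtain r where r: "strict_mono r" "(z \<circ> r) \<longlonglongrightarrow> l"
      using l unfolding cluster_points_def by blast
    \<comment> \<open>The limit is approached by results of passes: \<open>z (Suc (k n))\<close> is
      the term with index \<open>r (n + 2)\<close>. The shift by \<open>2\<close> ensures that pass
      \<open>k n\<close> exists and that \<open>k n - 1\<close> still tends to infinity.\<close>
    define k where "k n = r (n + 2) - 1" for n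
    have le: "n + 2 \<le> r (n + 2)" for n using r(1) by (rule strict_mono_imp_increasing)
    have rk: "r (n + 2) = Suc (k n)" and k1: "1 \<le> k n" and k_ge: "n \<le> k n - 1" "n \<le> k n" for n
      using le[of n] unfolding k_def by linarith+
    have "filterlim (\<lambda>n. k n - 1) sequentially sequentially" "filterlim k sequentially sequentially"
      using k_ge by (auto intro!: filterlim_at_top_mono[OF filterlim_ident] always_eventually intro: order_trans)
    \<comment> \<open>These are the step into \<open>z (k n)\<close> and the step out of it. The
      first bounds the extrapolation, the second makes \<open>z (k n)\<close> share the limit
      \<open>l\<close>.\<close>
    note d = filterlim_compose[OF diff this(1)] filterlim_compose[OF diff this(2)]
    have p: "(\<lambda>n. z (Suc (k n))) \<longlonglongrightarrow> l"
      using LIMSEQ_ignore_initial_segment[OF r(2), of 2] unfolding o_def rk .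
    from tendsto_diff[OF this d(2)] have zk: "(\<lambda>n. z (k n)) \<longlonglongrightarrow> l" by simp
    have d': "(\<lambda>n. norm (z (k n) - z (k n - 1))) \<longlonglongrightarrow> 0"
    proof -
      have "Suc (k n - 1) = k n" for n using k1[of n] by simp
      with tendsto_norm_zero[OF d(1)] show ?thesis by simp
    qed
    have "(\<lambda>n. Y (k n) - z (k n)) \<longlonglongrightarrow> 0"
      by (rule Lim_null_comparison[OF _ d']) (use Yz k1 in simp)
    from tendsto_add[OF this zk] have y: "(\<lambda>n. Y (k n)) \<longlonglongrightarrow> l" by simp
    have "\<Phi> (z (Suc (k n))) \<le> \<Phi> x + ereal (sweep_gradient N blk H (z (Suc (k n))) (Y (k n)) (z (k n)) \<bullet> (x - z (Suc (k n)))
        + K * (norm (x - Y (k n)))\<^sup>2)" if "norm (x - Y (k n)) \<le> 1" for n x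
      unfolding \<Phi>_def K_def
    proof (rule pass_approx_minimiser[OF blocks H pass[OF k1[of n]] Y_def[of "k n"]])
      show "0 < \<sigma>" "\<And>i. i \<in> {1..N} \<Longrightarrow> \<sigma> \<le> ch_sigma (c i (k n))"
        using sigma sg k1 unfolding \<sigma>_def by blast+
    qed (use met M0 YR[OF k1[of n]] that in blast)+
    from approx_minimisers_limit[OF H H' lsc \<Phi>_proper \<Phi>C K this p y tendsto_sweep_gradient[OF blocks H' p y zk]]
    have lim: "(\<lambda>n. ?J (z (Suc (k n)))) \<longlonglongrightarrow> ?J l" and crit: "l \<in> crit ?J"
      unfolding J by blast+
    \<comment> \<open>The limit \<open>v\<close> belongs to the whole sequence and does not depend
      on \<open>l\<close>, which is why the objective is constant on the cluster points.\<close>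
    have "(\<lambda>n. ?J (z (Suc (k n)))) \<longlonglongrightarrow> ereal v"
      using LIMSEQ_ignore_initial_segment[OF LIMSEQ_subseq_LIMSEQ[OF v r(1)], of 2] unfolding o_def rk .
    with lim crit show ?thesis using LIMSEQ_unique by blast
  qed
  then show ?thesis unfolding constant_on_def by blast
qed

end
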